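(* Let $\pi$ be a group whose underlying set has non-measurable cardinality. Then there exist a compact Hausdorff space $K$ and a point $x_0\in K$ such that the fundamental group $\pi_1(K,x_0)$ is isomorphic to $\pi$.
   Context: All spaces are assumed to be Hausdorff. The space $K$ is not required to be path connected. Measurability of cardinals is in the sense of Gillman and Jerison (Rings of Continuous Functions, Chapter 12): a cardinal $\kappa$ is called measurable if, for a set $S$ of cardinality $\kappa$, there is a countably additive function $\mu$ defined on all subsets of $S$, with values in $\{0,1\}$, such that $\mu(S)=1$ and $\mu(\{s\})=0$ for every $s\in S$ (equivalently, $S$ carries a nonprincipal countably complete ultrafilter). A cardinal is non-measurable if it is not measurable in this sense. *)

theory Defs
  imports "HOL-Analysis.Analysis" "HOL-Algebra.Group"
begin

text \<open>
  Measurability of the cardinal of \<open>S\<close> in the sense of Gillman and Jerison: a two-valued, countably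
  additive measure on all subsets of \<open>S\<close> that vanishes on singletons. This is invariant under
  bijections. It is weaker than measurability in the modern set-theoretic sense
  (\<open>\<kappa>\<close>-completeness is not required).
\<close>

definition measurable_cardinality :: "'a set \<Rightarrow> bool" where
  "measurable_cardinality S \<longleftrightarrow>
     (\<exists>M :: 'a measure. space M = S \<and> sets M = Pow S \<and>
        (\<forall>A\<subseteq>S. emeasure M A \<in> {0, 1}) \<and>
        emeasure M S = 1 \<and> (\<forall>s\<in>S. emeasure M {s} = 0))"

definition loops :: "'a topology \<Rightarrow> 'a \<Rightarrow> (real \<Rightarrow> 'a) set" where
  "loops X x0 = {p. pathin X p \<and> p 0 = x0 \<and> p 1 = x0}"

text \<open>
  The operations \<^const>\<open>homotopic_paths\<close> and \<^const>\<open>joinpaths\<close> of the library are tied to the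
  class of topological spaces; the following are their counterparts for a value of type
  \<^type>\<open>topology\<close>.
\<close>

definition loop_homotopy :: "'a topology \<Rightarrow> 'a \<Rightarrow> ((real \<Rightarrow> 'a) \<times> (real \<Rightarrow> 'a)) set" where
  "loop_homotopy X x0 =
     {(p, q). homotopic_with (\<lambda>r. r 0 = x0 \<and> r 1 = x0) (top_of_set {0..1}) X p q}"

definition loop_join :: "(real \<Rightarrow> 'a) \<Rightarrow> (real \<Rightarrow> 'a) \<Rightarrow> real \<Rightarrow> 'a" where
  "loop_join p q = (\<lambda>t. if t \<le> 1/2 then p (2 * t) else q (2 * t - 1))"

text \<open>
  The union in the multiplication is over representatives; all of them give the same class
  (lemma \<open>loop_join_respects\<close>).
\<close>

definition fundamental_group :: "'a topology \<Rightarrow> 'a \<Rightarrow> (real \<Rightarrow> 'a) set monoid" where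
  "fundamental_group X x0 =
     \<lparr>carrier = loops X x0 // loop_homotopy X x0,
      mult = (\<lambda>A B. \<Union>p\<in>A. \<Union>q\<in>B. loop_homotopy X x0 `` {loop_join p q}),
      one = loop_homotopy X x0 `` {\<lambda>_. x0}\<rparr>"

text \<open>
  HOL cannot quantify existentially over types, so the points of the space to be constructed need a
  fixed type. If \<open>'a\<close> has at least two elements, there are at least as many functions
  \<open>real \<Rightarrow> 'a\<close> as there are elements of \<open>'a\<close> and of \<open>real\<close>, so spaces \<open>X\<close> of cardinality at most
  \<open>max |'a| |real|\<close> (such as classifying spaces of groups on \<open>'a\<close>) can be realised on subsets of
  \<open>real \<Rightarrow> 'a\<close>. The Stone-Cech compactification of \<open>X\<close> is then a subset of the power of the unit
  interval indexed by the continuous functions on \<open>X\<close>, hence lives on the following type.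
\<close>

type_synonym 'a cube_point = "((real \<Rightarrow> 'a) \<Rightarrow> real) \<Rightarrow> real"

lemma loop_join_eq_joinpaths: "loop_join p q = p +++ q"
  by (simp add: loop_join_def joinpaths_def)

lemma loop_homotopy_eq_homotopic_paths:
  assumes "p \<in> loops (top_of_set S) x0"
  shows "(p, q) \<in> loop_homotopy (top_of_set S) x0 \<longleftrightarrow> homotopic_paths S p q"
  using assms
  by (simp add: loops_def loop_homotopy_def homotopic_paths_def pathstart_def pathfinish_def)

lemma equiv_loop_homotopy: "equiv (loops X x0) (loop_homotopy X x0)"
proof (rule equivI)
  show "loop_homotopy X x0 \<subseteq> loops X x0 \<times> loops X x0"
    by (auto simp: loop_homotopy_def loops_def pathin_def
        dest: homotopic_with_imp_continuous_maps homotopic_with_imp_property)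
  show "refl_on (loops X x0) (loop_homotopy X x0)"
    by (auto simp: refl_on_def loop_homotopy_def loops_def pathin_def)
  show "sym (loop_homotopy X x0)"
    by (auto simp: sym_def loop_homotopy_def homotopic_with_symD)
  show "trans (loop_homotopy X x0)"
    by (auto simp: trans_def loop_homotopy_def intro: homotopic_with_trans)
qed

lemma loop_join_respects:
  assumes "(p, p') \<in> loop_homotopy X x0" "(q, q') \<in> loop_homotopy X x0"
  shows "(loop_join p q, loop_join p' q') \<in> loop_homotopy X x0"
proof -
  let ?I = "top_of_set {0..1::real}"
  obtain h where h: "continuous_map (prod_topology ?I ?I) X h"
      "\<And>x. h (0, x) = p x" "\<And>x. h (1, x) = p' x"
      "\<And>t. t \<in> {0..1} \<Longrightarrow> h (t, 0) = x0 \<and> h (t, 1) = x0"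
    using assms(1) by (auto simp: loop_homotopy_def homotopic_with_def)
  obtain k where k: "continuous_map (prod_topology ?I ?I) X k"
      "\<And>x. k (0, x) = q x" "\<And>x. k (1, x) = q' x"
      "\<And>t. t \<in> {0..1} \<Longrightarrow> k (t, 0) = x0 \<and> k (t, 1) = x0"
    using assms(2) by (auto simp: loop_homotopy_def homotopic_with_def)
  define f where "f = (\<lambda>z. h (fst z, 2 * snd z))"
  define g where "g = (\<lambda>z. k (fst z, 2 * snd z - 1))"
  define m where "m = (\<lambda>z :: real \<times> real. if snd z \<le> 1/2 then f z else g z)"
  let ?Z = "prod_topology ?I ?I"
  have Z: "?Z = top_of_set ({0..1} \<times> {0..1})"
    by (simp add: subtopology_Times)
  have "continuous_map ?Z X m"
    unfolding m_def
  proof (rule continuous_map_cases_le)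
    show "continuous_map ?Z euclideanreal snd" "continuous_map ?Z euclideanreal (\<lambda>z. 1/2)"
      by (auto simp: Z intro!: continuous_intros)
    show "continuous_map (subtopology ?Z {z \<in> topspace ?Z. snd z \<le> 1/2}) X f"
      unfolding f_def
      by (rule continuous_map_compose[OF _ h(1), unfolded o_def])
         (auto simp: Z subtopology_subtopology intro!: continuous_intros)
    show "continuous_map (subtopology ?Z {z \<in> topspace ?Z. 1/2 \<le> snd z}) X g"
      unfolding g_def
      by (rule continuous_map_compose[OF _ k(1), unfolded o_def])
         (auto simp: Z subtopology_subtopology intro!: continuous_intros)
    show "f z = g z" if "z \<in> topspace ?Z" "snd z = 1/2" for z
    proof -
      have "2 * snd z = 1" "fst z \<in> {0..1}"
        using that by auto
      then show ?thesis
        using h(4)[of "fst z"] k(4)[of "fst z"] by (simp add: f_def g_def)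
    qed
  qed
  moreover have "m (0, x) = loop_join p q x" "m (1, x) = loop_join p' q' x" for x
    by (simp_all add: m_def f_def g_def loop_join_def h(2,3) k(2,3))
  moreover have "m (t, 0) = x0 \<and> m (t, 1) = x0" if "t \<in> {0..1}" for t
    using h(4)[OF that] k(4)[OF that] by (simp add: m_def f_def g_def)
  ultimately show ?thesis
    unfolding loop_homotopy_def homotopic_with_def by blast
qed

end

theory Submission
  imports Defs
begin

text \<open>
  Let \<open>E\<close> be the space of functions \<open>[0,1) \<rightarrow> G\<close> that are locally constant to the right, with the metric
  ``measure of the set where two functions differ''. Any two paths in \<open>E\<close> with common end points are
  homotopic, by following one function up to \<open>c\<close> and the other one after \<open>c\<close>, and \<open>G\<close> acts by left
  multiplication, moving every point by distance \<open>1\<close>. So \<open>E \<rightarrow> X = E / G\<close> is a covering, and \<open>X\<close> is a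
  metric space with fundamental group \<open>G\<close>.

  A path in the Stone-Cech compactification \<open>K\<close> of \<open>X\<close> that starts in \<open>X\<close> cannot reach a zero of (the
  extension of) a continuous \<open>g > 0\<close> on \<open>X\<close>: the bounded function \<open>cos (1/g)\<close> also extends to \<open>K\<close>, and it
  would oscillate along the path. If \<open>X\<close> is realcompact, such zeros exhaust \<open>K - X\<close>, so loops and
  homotopies in \<open>K\<close> based at a point of \<open>X\<close> stay in \<open>X\<close>. Finally, \<open>X\<close> is realcompact because it is
  metric of non-measurable cardinality, an element of \<open>X\<close> being determined by its values at the
  rationals.
\<close>

section \<open>The Stone-Cech compactification\<close>

text \<open>Members are \<open>undefined\<close> off the space, so every continuous function on it
  gives exactly one coordinate of the cube.\<close>

definition unit_functions :: "'a topology \<Rightarrow> ('a \<Rightarrow> real) set" where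
  "unit_functions X = {f \<in> extensional (topspace X). continuous_map X (top_of_set {0..1}) f}"

definition unit_cube :: "'a topology \<Rightarrow> (('a \<Rightarrow> real) \<Rightarrow> real) topology" where
  "unit_cube X = product_topology (\<lambda>_. top_of_set {0..1}) (unit_functions X)"

definition unit_eval :: "'a topology \<Rightarrow> 'a \<Rightarrow> ('a \<Rightarrow> real) \<Rightarrow> real" where
  "unit_eval X x = (\<lambda>f\<in>unit_functions X. f x)"

definition stone_cech :: "'a topology \<Rightarrow> (('a \<Rightarrow> real) \<Rightarrow> real) topology" where
  "stone_cech X = subtopology (unit_cube X) (unit_cube X closure_of (unit_eval X ` topspace X))"

text \<open>The extension is the coordinate projection that belongs to \<open>f\<close>; restricting
  turns \<open>f\<close> into the extensional function that indexes this coordinate.\<close>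

definition stone_extension :: "'a topology \<Rightarrow> ('a \<Rightarrow> real) \<Rightarrow> (('a \<Rightarrow> real) \<Rightarrow> real) \<Rightarrow> real" where
  "stone_extension X f p = p (restrict f (topspace X))"

lemma restrict_in_unit_functions:
  "continuous_map X (top_of_set {0..1}) f \<Longrightarrow> restrict f (topspace X) \<in> unit_functions X"
  by (auto simp: unit_functions_def intro: continuous_map_eq)

lemma unit_eval_in_unit_cube: "x \<in> topspace X \<Longrightarrow> unit_eval X x \<in> topspace (unit_cube X)"
  by (auto simp: unit_cube_def unit_eval_def unit_functions_def continuous_map_def)

lemma topspace_stone_cech:
  "topspace (stone_cech X) = unit_cube X closure_of (unit_eval X ` topspace X)"
  by (simp add: stone_cech_def closure_of_subset_topspace Int_absorb1)

lemma compact_space_stone_cech: "compact_space (stone_cech X)"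
proof -
  have "compact_space (unit_cube X)"
    by (simp add: unit_cube_def compact_space_product_topology compact_space_subtopology)
  then show ?thesis
    by (simp add: stone_cech_def closedin_compact_space compact_space_subtopology)
qed

lemma Hausdorff_space_stone_cech: "Hausdorff_space (stone_cech X)"
  by (simp add: stone_cech_def unit_cube_def Hausdorff_space_subtopology
      Hausdorff_space_product_topology)

lemma embedding_map_unit_eval:
  assumes "completely_regular_space X" "Hausdorff_space X"
  shows "embedding_map X (stone_cech X) (unit_eval X)"
proof -
  \<comment> \<open>The embedding theorem indexes its cube by the points of a metric space of
    bounded functions; these are the unit functions, which are bounded by their range.\<close>
  have "mspace (submetric (cfunspace X euclidean_metric) {f. f \<in> topspace X \<rightarrow> {0..1}})
      = unit_functions X"
    by (auto simp: unit_functions_def continuous_map_in_subtopology image_subset_iff Pi_iff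
        intro!: bounded_subset[OF bounded_closed_interval[of 0 "1::real"]])
  then have "embedding_map X (unit_cube X) (unit_eval X)"
    using completely_regular_space_cube_embedding_explicit[OF assms]
    by (simp add: unit_cube_def unit_eval_def[abs_def])
  then show ?thesis
    unfolding stone_cech_def embedding_map_in_subtopology
    by (metis closure_of_subset image_subset_iff image_subset_iff_funcset unit_eval_in_unit_cube)
qed

lemma stone_extension_unit_eval:
  assumes "continuous_map X (top_of_set {0..1}) f" "x \<in> topspace X"
  shows "stone_extension X f (unit_eval X x) = f x"
  using restrict_in_unit_functions[OF assms(1)] assms(2)
  by (simp add: stone_extension_def unit_eval_def)

lemma continuous_map_stone_extension:
  assumes "continuous_map X (top_of_set {0..1}) f"
  shows "continuous_map (stone_cech X) (top_of_set {0..1}) (stone_extension X f)"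
  unfolding stone_cech_def unit_cube_def stone_extension_def
  by (intro continuous_map_from_subtopology continuous_map_product_projection
      restrict_in_unit_functions assms)

lemma continuous_map_stone_extension_real:
  assumes "continuous_map X (top_of_set {0..1}) f"
  shows "continuous_map (stone_cech X) euclideanreal (stone_extension X f)"
  using continuous_map_stone_extension[OF assms] by (simp add: continuous_map_in_subtopology)

lemma stone_extension_range:
  assumes "continuous_map X (top_of_set {0..1}) f" "p \<in> topspace (stone_cech X)"
  shows "stone_extension X f p \<in> {0..1}"
  using continuous_map_stone_extension[OF assms(1)] assms(2) by (auto simp: continuous_map_def)

text \<open>The image of \<open>X\<close> is dense in the compactification, so identities between
  extensions can be checked on \<open>X\<close>.\<close>

lemma stone_cech_continuous_maps_eq:
  assumes "continuous_map (stone_cech X) Y u" "continuous_map (stone_cech X) Y v"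
    and "Hausdorff_space Y"
    and "\<And>x. x \<in> topspace X \<Longrightarrow> u (unit_eval X x) = v (unit_eval X x)"
    and "p \<in> topspace (stone_cech X)"
  shows "u p = v p"
proof -
  have "unit_eval X ` topspace X \<subseteq> unit_cube X closure_of (unit_eval X ` topspace X)"
    by (metis closure_of_subset image_subset_iff unit_eval_in_unit_cube)
  then have "p \<in> stone_cech X closure_of (unit_eval X ` topspace X)"
    using assms(5) unfolding topspace_stone_cech
    by (simp add: stone_cech_def closure_of_subtopology_subset closure_of_subtopology Int_absorb1)
  then show ?thesis
    using forall_in_closure_of_eq[OF _ assms(3,1,2)] assms(4) by blast
qed

section \<open>Zero sets of extensions, and paths that start in the space\<close>

lemma continuous_map_halving_series:
  assumes "\<And>n. continuous_map X euclideanreal (u n)"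
    and "\<And>n x. x \<in> topspace X \<Longrightarrow> \<bar>u n x\<bar> \<le> 1"
  shows "continuous_map X euclideanreal (\<lambda>x. \<Sum>n. (1/2) ^ Suc n * u n x)"
proof -
  have lim: "uniform_limit (topspace X) (\<lambda>n x. \<Sum>i<n. (1/2) ^ Suc i * u i x)
      (\<lambda>x. \<Sum>n. (1/2) ^ Suc n * u n x) sequentially"
  proof (rule Weierstrass_m_test)
    show "summable (\<lambda>n. (1/2::real) ^ Suc n)"
      by (rule sums_summable[OF power_half_series])
    show "norm ((1/2) ^ Suc n * u n x) \<le> (1/2) ^ Suc n" if "x \<in> topspace X" for n x
      using assms(2)[OF that, of n] by (simp add: abs_mult mult_left_le)
  qed
  have "continuous_map X Met_TC.mtopology (\<lambda>x. \<Sum>n. (1/2) ^ Suc n * u n x)"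
  proof (rule Met_TC.continuous_map_uniform_limit)
    show "\<forall>\<^sub>F n in sequentially. continuous_map X Met_TC.mtopology (\<lambda>x. \<Sum>i<n. (1/2) ^ Suc i * u i x)"
      using assms(1) by (auto intro!: always_eventually continuous_intros)
  qed (use uniform_limitD[OF lim] in auto)
  then show ?thesis
    by simp
qed

text \<open>
  Equivalently: every point of the compactification outside \<open>X\<close> lies on a zero set that misses \<open>X\<close>.
\<close>

definition realcompact_space :: "'a topology \<Rightarrow> bool" where
  "realcompact_space X \<longleftrightarrow>
     (\<forall>p \<in> topspace (stone_cech X).
        (\<forall>f. continuous_map X (top_of_set {0..1}) f \<longrightarrow> (\<forall>x\<in>topspace X. f x > 0)
              \<longrightarrow> stone_extension X f p > 0)
        \<longrightarrow> p \<in> unit_eval X ` topspace X)"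

text \<open>This is countable completeness at \<open>p\<close>: if the values \<open>c n\<close>
  were not attained together, the weighted sum of the \<open>|f n - c n|\<close> would be positive
  on \<open>X\<close>, while its extension vanishes at \<open>p\<close>.\<close>

lemma stone_cech_joint_realization:
  assumes p: "p \<in> topspace (stone_cech X)"
    and pos: "\<And>f. \<lbrakk>continuous_map X (top_of_set {0..1}) f; \<forall>x\<in>topspace X. f x > 0\<rbrakk>
               \<Longrightarrow> stone_extension X f p > 0"
    and f: "\<And>n::nat. continuous_map X (top_of_set {0..1}) (f n)"
  shows "\<exists>x\<in>topspace X. \<forall>n. f n x = stone_extension X (f n) p"
proof (rule ccontr)
  assume contra: "\<not> ?thesis"
  define c where "c n = stone_extension X (f n) p" for n
  define S where "S v = (\<Sum>n. (1/2) ^ Suc n * \<bar>v n - c n\<bar>)" for v :: "nat \<Rightarrow> real"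
  have c: "c n \<in> {0..1}" for n
    unfolding c_def by (rule stone_extension_range[OF f p])
  have bound: "\<bar>v n - c n\<bar> \<le> 1" if "\<And>n. v n \<in> {0..1}" for v n
    using that[of n] c[of n] by auto
  have summable: "summable (\<lambda>n. (1/2) ^ Suc n * \<bar>v n - c n\<bar>)" if "\<And>n. v n \<in> {0..1}" for v
  proof (rule summable_comparison_test'[OF sums_summable[OF power_half_series]])
    show "norm ((1/2) ^ Suc n * \<bar>v n - c n\<bar>) \<le> (1/2) ^ Suc n" for n
      using bound[of v n] that by (simp add: abs_mult mult_left_le)
  qed
  have S_le: "S v \<le> 1" if "\<And>n. v n \<in> {0..1}" for v
  proof -
    have "S v \<le> (\<Sum>n. (1/2) ^ Suc n)"
      unfolding S_def using bound[of v, OF that]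
      by (intro suminf_le summable that sums_summable[OF power_half_series])
         (simp add: mult_left_le)
    then show ?thesis
      using power_half_series sums_unique by fastforce
  qed
  have S_ge: "S v \<ge> 0" if "\<And>n. v n \<in> {0..1}" for v
    unfolding S_def by (intro suminf_nonneg summable that) auto
  have S_pos: "S v > 0" if "\<And>n. v n \<in> {0..1}" "v \<noteq> c" for v
  proof -
    obtain i where "v i \<noteq> c i"
      using \<open>v \<noteq> c\<close> by (auto simp: fun_eq_iff)
    then show ?thesis
      unfolding S_def by (intro suminf_pos2[OF summable[OF that(1)], where i = i]) auto
  qed
  \<comment> \<open>Stated for any domain, because it is applied to the \<open>f n\<close> on
    \<open>X\<close> and to their extensions on the compactification.\<close>
  have cont: "continuous_map Y euclideanreal (\<lambda>y. S (\<lambda>n. u n y))"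
    if u: "\<And>n. continuous_map Y (top_of_set {0..1}) (u n)" for Y :: "'b topology" and u
    unfolding S_def
  proof (rule continuous_map_halving_series)
    show "continuous_map Y euclideanreal (\<lambda>y. \<bar>u n y - c n\<bar>)" for n
      using u[of n] by (auto simp: continuous_map_in_subtopology intro!: continuous_intros)
    show "\<bar>\<bar>u n y - c n\<bar>\<bar> \<le> 1" if "y \<in> topspace Y" for n y
    proof -
      have "u m y \<in> {0..1}" for m
        using u[of m] that by (auto simp: continuous_map_def)
      then have "\<bar>u n y - c n\<bar> \<le> 1"
        by (rule bound)
      then show ?thesis
        by simp
    qed
  qed
  have f01: "f n x \<in> {0..1}" if "x \<in> topspace X" for n x
    using f[of n] that by (auto simp: continuous_map_def)
  define g where "g x = S (\<lambda>n. f n x)" for x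
  have g: "continuous_map X (top_of_set {0..1}) g"
    unfolding g_def continuous_map_in_subtopology using cont[OF f] f01 S_le S_ge by auto
  have "g x > 0" if "x \<in> topspace X" for x
    unfolding g_def using contra that f01[OF that] by (intro S_pos) (auto simp: c_def fun_eq_iff)
  then have "stone_extension X g p > 0"
    using pos[OF g] by blast
  \<comment> \<open>Both sides are continuous in \<open>p\<close> and agree on \<open>X\<close>; on
    the right every summand is zero at \<open>p\<close>.\<close>
  moreover have "stone_extension X g p = S (\<lambda>n. stone_extension X (f n) p)"
    by (rule stone_cech_continuous_maps_eq[OF continuous_map_stone_extension_real[OF g]
          cont[OF continuous_map_stone_extension[OF f]] _ _ p])
       (simp_all add: stone_extension_unit_eval[OF g] stone_extension_unit_eval[OF f] g_def)
  ultimately show False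
    by (simp add: S_def c_def)
qed

text \<open>At a first zero \<open>t0\<close> of the extension of \<open>g\<close> along the path,
  the extension of \<open>\<psi> \<circ> g\<close> would be continuous although it takes the values
  0 and 1 arbitrarily close to \<open>t0\<close>.\<close>

lemma stone_cech_path_positive:
  assumes \<gamma>: "pathin (stone_cech X) \<gamma>" "\<gamma> 0 = unit_eval X a" and a: "a \<in> topspace X"
    and g: "continuous_map X (top_of_set {0..1}) g" and pos: "\<And>x. x \<in> topspace X \<Longrightarrow> g x > 0"
    and t: "t \<in> {0..1}"
  shows "stone_extension X g (\<gamma> t) > 0"
proof (rule ccontr)
  assume contra: "\<not> ?thesis"
  define \<psi> :: "real \<Rightarrow> real" where "\<psi> u = (1 + cos (1 / u)) / 2" for u
  have \<psi>: "continuous_on {0<..} \<psi>"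
    unfolding \<psi>_def by (auto intro!: continuous_intros)
  have "(1 + c) / 2 \<in> {0..1}" if "-1 \<le> c" "c \<le> 1" for c :: real
    using that by auto
  then have \<psi>01: "\<psi> u \<in> {0..1}" for u
    unfolding \<psi>_def using cos_ge_minus_one cos_le_one by blast
  define f where "f = \<psi> \<circ> g"
  have f: "continuous_map X (top_of_set {0..1}) f"
    unfolding f_def
  proof (rule continuous_map_compose)
    show "continuous_map X (top_of_set {0<..}) g"
      using g pos by (auto simp: continuous_map_in_subtopology)
    show "continuous_map (top_of_set {0<..}) (top_of_set {0..1}) \<psi>"
      using \<psi> \<psi>01 by auto
  qed
  define h where "h t = stone_extension X g (\<gamma> t)" for t
  define k where "k t = stone_extension X f (\<gamma> t)" for t
  have \<gamma>K: "continuous_map (top_of_set {0..1}) (stone_cech X) \<gamma>"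
    using \<gamma>(1) by (simp add: pathin_def)
  have h: "continuous_on {0..1} h" and k: "continuous_on {0..1} k"
    using continuous_map_compose[OF \<gamma>K continuous_map_stone_extension_real[OF g]]
      continuous_map_compose[OF \<gamma>K continuous_map_stone_extension_real[OF f]]
    by (simp_all add: h_def[abs_def] k_def[abs_def] o_def)
  have \<gamma>_in: "\<gamma> s \<in> topspace (stone_cech X)" if "s \<in> {0..1}" for s
    using \<gamma>K that by (auto simp: continuous_map_def)
  have h01: "h s \<in> {0..1}" if "s \<in> {0..1}" for s
    unfolding h_def by (rule stone_extension_range[OF g \<gamma>_in[OF that]])
  have h0: "h 0 > 0"
    using pos[OF a] by (simp add: h_def \<gamma> stone_extension_unit_eval[OF g a])
  have kh: "k s = \<psi> (h s)" if s: "s \<in> {0..1}" and "h s > 0" for s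
  proof -
    define c where "c = h s / 2"
    have "c > 0"
      using that by (simp add: c_def)
    have \<psi>c: "continuous_on UNIV (\<lambda>u. \<psi> (max c u))"
      using \<open>c > 0\<close> by (intro continuous_on_compose2[OF \<psi>] continuous_intros) auto
    let ?g = "stone_extension X g" and ?f = "stone_extension X f"
    \<comment> \<open>Since \<psi> is discontinuous at 0, the identity
      \<open>f = \<psi> \<circ> g\<close> is extended only where \<open>g\<close> exceeds a positive
      \<open>c\<close>. On \<open>X\<close> the first factor vanishes where \<open>g\<close> is at
      most \<open>c\<close>, the second one elsewhere; at \<open>\<gamma> s\<close> the first factor
      is \<open>h s / 2\<close>.\<close>
    have "max 0 (?g (\<gamma> s) - c) * (?f (\<gamma> s) - \<psi> (max c (?g (\<gamma> s)))) = 0"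
    proof (rule stone_cech_continuous_maps_eq[where Y = euclideanreal and v = "\<lambda>_. 0", OF _ _ _ _ \<gamma>_in[OF s]])
      have "continuous_map (stone_cech X) euclideanreal ((\<lambda>u. \<psi> (max c u)) \<circ> ?g)"
        using \<psi>c by (intro continuous_map_compose[OF continuous_map_stone_extension_real[OF g]]) auto
      then show "continuous_map (stone_cech X) euclideanreal
          (\<lambda>p. max 0 (?g p - c) * (?f p - \<psi> (max c (?g p))))"
        by (intro continuous_intros continuous_map_stone_extension_real f g)
           (auto simp: o_def intro!: continuous_intros continuous_map_stone_extension_real f g)
      show "max 0 (?g (unit_eval X x) - c) * (?f (unit_eval X x) - \<psi> (max c (?g (unit_eval X x)))) = 0"
        if "x \<in> topspace X" for x
        unfolding stone_extension_unit_eval[OF g that] stone_extension_unit_eval[OF f that]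
        by (simp add: f_def max_def)
    qed auto
    then show ?thesis
      using \<open>h s > 0\<close> by (auto simp: h_def k_def c_def max_def split: if_splits)
  qed
  define Z where "Z = {s \<in> {0..1}. h s = 0}"
  have "h t = 0"
    using contra h01[OF t] by (simp add: h_def)
  then have "Z \<noteq> {}"
    using t by (auto simp: Z_def)
  moreover have "closed Z"
    unfolding Z_def using continuous_closed_preimage_constant[OF h] by simp
  moreover have "bdd_below Z"
    by (auto simp: Z_def)
  ultimately have "Inf Z \<in> Z"
    by (simp add: closed_contains_Inf)
  define t0 where "t0 = Inf Z"
  have t0: "t0 \<in> {0..1}" "h t0 = 0"
    using \<open>Inf Z \<in> Z\<close> by (auto simp: Z_def t0_def)
  have "h s > 0" if "s \<in> {0..<t0}" for s
  proof -
    have "s \<notin> Z"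
      using cInf_lower[OF _ \<open>bdd_below Z\<close>, of s] that by (auto simp: t0_def)
    then show ?thesis
      using that t0 h01[of s] by (auto simp: Z_def)
  qed
  have "t0 > 0"
    using t0 h0 by (cases "t0 = 0") auto
  obtain \<delta> where "\<delta> > 0" and \<delta>: "\<And>s. s \<in> {0..1} \<Longrightarrow> dist s t0 < \<delta> \<Longrightarrow> dist (k s) (k t0) < 1/2"
    using k t0(1) unfolding continuous_on_iff by (metis half_gt_zero_iff zero_less_one)
  \<comment> \<open>On \<open>{s..t0}\<close> the function \<open>k\<close> stays within 1/2 of
    \<open>k t0\<close>; the maximum with 0 keeps \<open>s\<close> in the unit interval.\<close>
  define s where "s = max 0 (t0 - \<delta> / 2)"
  have s: "0 \<le> s" "s < t0" "t0 - s < \<delta>"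
    using \<open>t0 > 0\<close> \<open>\<delta> > 0\<close> by (auto simp: s_def)
  have "h s > 0"
    using \<open>\<And>s. s \<in> {0..<t0} \<Longrightarrow> h s > 0\<close> s by auto
  have attained: "\<psi> u = k r \<and> dist (k r) (k t0) < 1/2" if "r \<in> {s..t0}" "h r = u" "u > 0" for r u
    using kh[of r] \<delta>[of r] that s t0 by (auto simp: dist_real_def)
  \<comment> \<open>Since \<open>h t0 = 0\<close>, the intermediate value theorem makes every
    positive \<open>u\<close> up to \<open>h s\<close> a value of \<open>h\<close> on
    \<open>{s..t0}\<close>.\<close>
  have near_k: "dist (\<psi> u) (k t0) < 1/2" if u: "0 < u" "u \<le> h s" for u
  proof -
    have "continuous_on {s..t0} h"
      using s t0 by (intro continuous_on_subset[OF h]) auto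
    then obtain r where "r \<ge> s" "r \<le> t0" "h r = u"
      using IVT2'[of h t0 u s] u s t0 by auto
    then show ?thesis
      using attained[of r u] u by auto
  qed
  \<comment> \<open>With this \<open>N\<close>, two points below \<open>h s\<close> are found at
    which \<psi> is 1 and 0; these values cannot both be closer than 1/2 to
    \<open>k t0\<close>.\<close>
  obtain N :: nat where N: "1 / (2 * pi * h s) < real N"
    using reals_Archimedean2 by blast
  then have "N > 0"
    using \<open>h s > 0\<close> by (cases "N = 0") (auto simp: divide_less_0_iff mult_less_0_iff)
  have "1 / (2 * pi * real N) \<le> h s"
    using N \<open>h s > 0\<close> \<open>N > 0\<close> by (simp add: field_simps)
  moreover have "1 / (2 * pi * real N + pi) \<le> 1 / (2 * pi * real N)"
    using \<open>N > 0\<close> by (intro frac_le) auto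
  moreover have "1 / (2 * pi * real N) > 0" "1 / (2 * pi * real N + pi) > 0"
    using \<open>N > 0\<close> by (auto intro: add_pos_pos)
  ultimately have "dist (\<psi> (1 / (2 * pi * real N))) (k t0) < 1/2"
    and "dist (\<psi> (1 / (2 * pi * real N + pi))) (k t0) < 1/2"
    using near_k[of "1 / (2 * pi * real N)"] near_k[of "1 / (2 * pi * real N + pi)"] order_trans
    by blast+
  moreover have "\<psi> (1 / (2 * pi * real N)) = 1" "\<psi> (1 / (2 * pi * real N + pi)) = 0"
    using cos_2npi[of N] by (simp_all add: \<psi>_def mult.commute mult.left_commute)
  ultimately show False
    by (auto simp: dist_real_def)
qed

lemma realcompact_space_path_in_image:
  assumes "realcompact_space X" "pathin (stone_cech X) \<gamma>" "\<gamma> 0 \<in> unit_eval X ` topspace X"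
    and t: "t \<in> {0..1}"
  shows "\<gamma> t \<in> unit_eval X ` topspace X"
proof -
  obtain a where "a \<in> topspace X" "\<gamma> 0 = unit_eval X a"
    using assms(3) by auto
  moreover have "\<gamma> t \<in> topspace (stone_cech X)"
    using assms(2) t by (auto simp: pathin_def continuous_map_def)
  ultimately show ?thesis
    using assms(1,2) t stone_cech_path_positive[of X \<gamma> a _ t] unfolding realcompact_space_def by blast
qed

section \<open>Metric spaces of non-measurable cardinality are realcompact\<close>

text \<open>
  The hypothesis on \<open>P\<close> says that its extension is a countably complete ultrafilter on \<open>S\<close>.
\<close>

lemma nonmeasurable_imp_principal:
  assumes nm: "\<not> measurable_cardinality S"
    and P: "\<And>B :: nat \<Rightarrow> 'a set. (\<And>k. B k \<subseteq> S) \<Longrightarrow> \<exists>a\<in>S. \<forall>k. P (B k) \<longleftrightarrow> a \<in> B k"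
  shows "\<exists>a\<in>S. P {a}"
proof (rule ccontr)
  assume contra: "\<not> ?thesis"
  define \<mu> :: "'a set \<Rightarrow> ennreal" where "\<mu> A = (if P A then 1 else 0)" for A
  let ?M = "measure_of S (Pow S) \<mu>"
  have "countably_additive (Pow S) \<mu>"
    unfolding countably_additive_def
  proof (intro allI impI)
    fix A :: "nat \<Rightarrow> 'a set"
    assume A: "range A \<subseteq> Pow S" "disjoint_family A"
    \<comment> \<open>The union is put in front of the sequence, so that one point \<open>a\<close>
      decides all the sets at once; additivity is then that of the point mass at
      \<open>a\<close>.\<close>
    have "case_nat (\<Union>i. A i) A k \<subseteq> S" for k
      using A(1) by (auto split: nat.splits)
    then obtain a where a: "\<And>k. P (case_nat (\<Union>i. A i) A k) \<longleftrightarrow> a \<in> case_nat (\<Union>i. A i) A k"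
      using P[of "case_nat (\<Union>i. A i) A"] by blast
    have eq: "\<mu> (A i) = indicator (A i) a" "\<mu> (\<Union>i. A i) = indicator (\<Union>i. A i) a" for i
      using a[of "Suc i"] a[of 0] by (auto simp: \<mu>_def indicator_def)
    show "(\<Sum>i. \<mu> (A i)) = \<mu> (\<Union>i. A i)"
      unfolding eq by (rule suminf_indicator[OF A(2)])
  qed
  moreover have "\<not> P {}" "P S"
    using P[of "\<lambda>_. {}"] P[of "\<lambda>_. S"] by auto
  then have "positive (Pow S) \<mu>" "\<mu> S = 1"
    by (simp_all add: positive_def \<mu>_def)
  ultimately have "emeasure ?M A = \<mu> A" if "A \<subseteq> S" for A
    using that by (intro emeasure_measure_of_sigma sigma_algebra_Pow) auto
  then have "measurable_cardinality S"
    unfolding measurable_cardinality_def using \<open>\<mu> S = 1\<close> contra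
    by (intro exI[of _ ?M]) (auto simp: \<mu>_def sigma_algebra.sigma_sets_eq[OF sigma_algebra_Pow])
  then show False
    using nm by simp
qed

section \<open>Bump functions and the trapping of a point of the compactification\<close>

context Metric_space
begin

text \<open>
  Inserting \<open>0\<close> truncates at \<open>0\<close> and gives the value \<open>0\<close> for empty \<open>S\<close>.
\<close>

definition bump :: "'a set \<Rightarrow> real \<Rightarrow> 'a \<Rightarrow> real" where
  "bump S r x = Sup (insert 0 ((\<lambda>y. 1 - d x y / r) ` S))"

lemma bdd_above_bump:
  assumes "r > 0"
  shows "bdd_above (insert 0 ((\<lambda>y. 1 - d x y / r) ` S))"
proof (rule bdd_aboveI[of _ 1])
  fix z assume "z \<in> insert 0 ((\<lambda>y. 1 - d x y / r) ` S)"
  moreover have "0 \<le> d x y / r" for y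
    using assms by simp
  ultimately show "z \<le> 1"
    by auto
qed

lemma bump_range:
  assumes "r > 0"
  shows "bump S r x \<in> {0..1}"
proof -
  have "d x y / r \<ge> 0" for y
    using assms by simp
  then have "bump S r x \<le> 1"
    unfolding bump_def by (intro cSup_least) auto
  moreover have "bump S r x \<ge> 0"
    unfolding bump_def by (rule cSup_upper[OF insertI1 bdd_above_bump[OF assms]])
  ultimately show ?thesis
    by simp
qed

lemma bump_ge: "\<lbrakk>r > 0; y \<in> S\<rbrakk> \<Longrightarrow> 1 - d x y / r \<le> bump S r x"
  unfolding bump_def by (rule cSup_upper[OF _ bdd_above_bump]) auto

lemma bump_pos_imp:
  assumes "r > 0" "bump S r x > 0"
  shows "\<exists>y\<in>S. d x y < r"
proof -
  obtain z where "z \<in> insert 0 ((\<lambda>y. 1 - d x y / r) ` S)" "z > 0"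
    using assms(2) unfolding bump_def
    by (subst (asm) less_cSup_iff[OF insert_not_empty bdd_above_bump[OF assms(1)]]) blast
  then show ?thesis
    using assms(1) by (auto simp: divide_less_eq_1)
qed

text \<open>Centres at distance at least \<open>r\<close> from \<open>x\<close> contribute nothing
  above the truncation value 0, so only the part of \<open>S\<close> near \<open>x\<close>
  matters.\<close>

lemma bump_mono_at:
  assumes "r > 0" "\<And>y. \<lbrakk>y \<in> S; d x y < r\<rbrakk> \<Longrightarrow> y \<in> T"
  shows "bump S r x \<le> bump T r x"
  unfolding bump_def[of S]
proof (rule cSup_least)
  fix z assume "z \<in> insert 0 ((\<lambda>y. 1 - d x y / r) ` S)"
  then consider "z = 0" | y where "y \<in> S" "z = 1 - d x y / r"
    by blast
  then show "z \<le> bump T r x"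
  proof cases
    case 1
    then show ?thesis
      using bump_range[OF assms(1)] by simp
  next
    case 2
    show ?thesis
    proof (cases "d x y < r")
      case True
      then show ?thesis
        using 2 assms bump_ge by blast
    next
      case False
      then have "z \<le> 0"
        using 2 assms(1) by simp
      then show ?thesis
        using bump_range[OF assms(1), of T x] by simp
    qed
  qed
qed simp

text \<open>Each function under the supremum has Lipschitz constant \<open>1 / r\<close>, and
  suprema inherit it.\<close>

lemma bump_Lipschitz:
  assumes "r > 0" "S \<subseteq> M" "x \<in> M" "x' \<in> M"
  shows "bump S r x \<le> bump S r x' + d x x' / r"
  unfolding bump_def[of S r x]
proof (rule cSup_least)
  fix z assume "z \<in> insert 0 ((\<lambda>y. 1 - d x y / r) ` S)"
  then consider "z = 0" | y where "y \<in> S" "z = 1 - d x y / r"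
    by blast
  then show "z \<le> bump S r x' + d x x' / r"
  proof cases
    case 1
    then show ?thesis
      using bump_range[OF assms(1), of S x'] assms(1) by simp
  next
    case 2
    then have "d x' y \<le> d x' x + d x y"
      using assms by (intro triangle) auto
    then have "d x' y / r \<le> (d x x' + d x y) / r"
      using assms(1) by (simp add: divide_right_mono commute)
    then have "1 - d x y / r \<le> 1 - d x' y / r + d x x' / r"
      by (simp add: add_divide_distrib)
    then show ?thesis
      using bump_ge[OF assms(1) 2(1), of x'] 2(2) by linarith
  qed
qed simp

lemma continuous_map_bump:
  assumes "r > 0" "S \<subseteq> M"
  shows "continuous_map mtopology (top_of_set {0..1}) (bump S r)"
proof -
  have "continuous_map mtopology Met_TC.mtopology (bump S r)"
    unfolding metric_continuous_map[OF Met_TC.Metric_space_axioms]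
  proof (intro conjI ballI allI impI)
    fix x e :: real and a assume "a \<in> M" "(e::real) > 0"
    have "dist (bump S r a) (bump S r x) < e" if "x \<in> M" "d a x < e * r" for x
    proof -
      have "d a x / r < e"
        using that assms(1) by (simp add: field_simps)
      then show ?thesis
        using bump_Lipschitz[OF assms \<open>a \<in> M\<close> \<open>x \<in> M\<close>] bump_Lipschitz[OF assms \<open>x \<in> M\<close> \<open>a \<in> M\<close>]
        by (simp add: dist_real_def commute abs_less_iff)
    qed
    then show "\<exists>\<delta>>0. \<forall>x. x \<in> M \<and> d a x < \<delta> \<longrightarrow> dist (bump S r a) (bump S r x) < e"
      using \<open>e > 0\<close> assms(1) by (intro exI[of _ "e * r"]) auto
  qed auto
  then show ?thesis
    using bump_range[OF assms(1)] by (auto simp: continuous_map_in_subtopology)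
qed

text \<open>Functions with positive extension at \<open>p\<close> that vanish outside smaller and
  smaller balls are realized at a common point \<open>x\<close>. Realizing any further function
  together with them shows that \<open>p\<close> agrees with \<open>x\<close> in every
  coordinate.\<close>

lemma realcompact_space_mtopology:
  assumes nm: "\<not> measurable_cardinality M"
  shows "realcompact_space mtopology"
  unfolding realcompact_space_def
proof (intro ballI impI)
  fix p
  assume p: "p \<in> topspace (stone_cech mtopology)"
    and pos': "\<forall>f. continuous_map mtopology (top_of_set {0..1}) f \<longrightarrow> (\<forall>x\<in>topspace mtopology. f x > 0)
              \<longrightarrow> stone_extension mtopology f p > 0"
  let ?ext = "\<lambda>f. stone_extension mtopology f p"
  have realize: "\<exists>x\<in>M. \<forall>n. f n x = ?ext (f n)"
    if "\<And>n::nat. continuous_map mtopology (top_of_set {0..1}) (f n)" for f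
  proof -
    have "\<exists>x\<in>topspace mtopology. \<forall>n. f n x = ?ext (f n)"
      by (rule stone_cech_joint_realization[OF p pos'[rule_format] that]) auto
    then show ?thesis
      by (simp only: topspace_mtopology)
  qed
  have small: "\<exists>\<alpha>\<in>M. \<exists>\<phi>. continuous_map mtopology (top_of_set {0..1}) \<phi> \<and> ?ext \<phi> > 0
      \<and> (\<forall>x\<in>M. \<phi> x > 0 \<longrightarrow> d \<alpha> x < r)" if r: "r > 0" for r
  proof -
    obtain R :: "('a \<times> 'a) set" where R: "well_order_on UNIV R"
      using well_order_on[of UNIV] by (rule exE)
    have wf: "wf (R - Id)"
      using R unfolding well_order_on_def by (rule conjunct2)
    have "antisym R" and total: "total_on UNIV R"
      using R by (simp_all add: well_order_on_def linear_order_on_def partial_order_on_def)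
    have anti: "a = b" if "(a, b) \<in> R" "(b, a) \<in> R" for a b
      by (rule antisymD[OF \<open>antisym R\<close> that])
    have tot: "(a, b) \<in> R \<or> (b, a) \<in> R" if "a \<noteq> b" for a b
      using total that by (simp add: total_on_def)
    have "\<exists>a\<in>M. d a x < r \<and> (\<forall>b\<in>M. d b x < r \<longrightarrow> b \<noteq> a \<longrightarrow> (a, b) \<in> R)" if "x \<in> M" for x
    proof -
      obtain a where a: "a \<in> {a \<in> M. d a x < r}" "\<And>b. (b, a) \<in> R - Id \<Longrightarrow> b \<notin> {a \<in> M. d a x < r}"
        using wfE_min[OF wf, of x "{a \<in> M. d a x < r}"] \<open>x \<in> M\<close> r by auto
      have "(a, b) \<in> R" if "b \<in> M" "d b x < r" "b \<noteq> a" for b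
        using a(2)[of b] tot[of a b] that by auto
      then show ?thesis
        using a(1) by blast
    qed
    then obtain lab where labM: "\<And>x. x \<in> M \<Longrightarrow> lab x \<in> M" and labr: "\<And>x. x \<in> M \<Longrightarrow> d (lab x) x < r"
      and first: "\<And>x b. \<lbrakk>x \<in> M; b \<in> M; d b x < r; b \<noteq> lab x\<rbrakk> \<Longrightarrow> (lab x, b) \<in> R"
      by metis
    \<comment> \<open>A. H. Stone's refinement: label a point by the first centre whose \<open>r\<close>-ball contains it. For fixed
      \<open>n\<close> the pieces \<open>V n {\<alpha>}\<close> are \<open>3/2^n\<close>-separated, so \<open>\<phi> n A\<close> is either \<open>0\<close> or \<open>\<phi> n M\<close> at each
      point, and \<open>A \<mapsto> ?ext (\<phi> n A) > 0\<close> is a countably complete ultrafilter on the labels.\<close>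
    define s :: "nat \<Rightarrow> real" where "s n = (1/2) ^ n" for n
    have s: "s n > 0" for n
      by (simp add: s_def)
    define V where "V n A = {x \<in> M. lab x \<in> A \<and> (\<forall>y\<in>M. d x y < 3 * s n \<longrightarrow> d (lab x) y < r)}" for n A
    have VM: "V n A \<subseteq> M" for n A
      by (auto simp: V_def)
    \<comment> \<open>If the labels differed, the ball around each label would contain the other
      point, so each label would precede the other in \<open>R\<close>.\<close>
    have same: "lab x = lab y" if "x \<in> V n A" "y \<in> V n B" "d x y < 3 * s n" for x y n A B
    proof (rule ccontr)
      assume "lab x \<noteq> lab y"
      moreover have "x \<in> M" "y \<in> M" "d (lab x) y < r" "d (lab y) x < r"
        using that by (auto simp: V_def commute)
      ultimately have "(lab x, lab y) \<in> R" "(lab y, lab x) \<in> R"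
        using first[of x "lab y"] first[of y "lab x"] labM by auto
      then show False
        using anti \<open>lab x \<noteq> lab y\<close> by blast
    qed
    \<comment> \<open>The slack \<open>r - d (lab x) x\<close> is positive and hence exceeds
      \<open>3 * s n\<close> for large \<open>n\<close>.\<close>
    have cover: "\<exists>n. x \<in> V n M" if x: "x \<in> M" for x
    proof -
      obtain n where n: "s n < (r - d (lab x) x) / 3"
        unfolding s_def using real_arch_pow_inv[of "(r - d (lab x) x) / 3" "1/2"] labr[OF x] by auto
      have "d (lab x) y < r" if "y \<in> M" "d x y < 3 * s n" for y
        using triangle[OF labM[OF x] x that(1)] that(2) n by simp
      then show ?thesis
        using x labM[OF x] by (auto simp: V_def)
    qed
    define \<phi> where "\<phi> n A = bump (V n A) (s n)" for n A
    have \<phi>: "continuous_map mtopology (top_of_set {0..1}) (\<phi> n A)" for n A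
      unfolding \<phi>_def by (rule continuous_map_bump[OF s VM])
    have label: "\<exists>\<alpha>\<in>M. \<forall>A. \<phi> n A x = (if \<alpha> \<in> A then \<phi> n M x else 0)"
      if "x \<in> M" and pos: "\<phi> n M x > 0" for x n
    proof -
      obtain y where y: "y \<in> V n M" "d x y < s n"
        using bump_pos_imp[of "s n" "V n M" x, OF s] pos by (auto simp: \<phi>_def)
      \<comment> \<open>Two points of the pieces within \<open>s n\<close> of \<open>x\<close> are
        less than \<open>2 * s n\<close> apart, so near \<open>x\<close> only one label
        occurs.\<close>
      have near: "lab z = lab y" if "z \<in> V n A" "d x z < s n" for z A
      proof (rule same[OF that(1) y(1)])
        have "d z y \<le> d z x + d x y"
          using that y VM \<open>x \<in> M\<close> by (intro triangle) auto
        then show "d z y < 3 * s n"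
          using that y s[of n] by (simp add: commute)
      qed
      have "\<phi> n A x = (if lab y \<in> A then \<phi> n M x else 0)" for A
      proof (cases "lab y \<in> A")
        case True
        have "z \<in> V n M" if "z \<in> V n A" for z
          using that labM by (auto simp: V_def)
        moreover have "z \<in> V n A" if "z \<in> V n M" "d x z < s n" for z
          using near[OF that] that(1) True by (simp add: V_def)
        ultimately have "\<phi> n A x \<le> \<phi> n M x" "\<phi> n M x \<le> \<phi> n A x"
          unfolding \<phi>_def by (intro bump_mono_at[OF s]; blast)+
        then show ?thesis
          using True by simp
      next
        case False
        have "\<not> \<phi> n A x > 0"
        proof
          assume "\<phi> n A x > 0"
          then obtain z where z: "z \<in> V n A" "d x z < s n"
            using bump_pos_imp[of "s n" "V n A" x, OF s] by (auto simp: \<phi>_def)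
          then have "lab z \<in> A"
            by (simp add: V_def)
          then show False
            using near[OF z] False by simp
        qed
        then show ?thesis
          using False bump_range[of "s n" "V n A" x, OF s] by (simp add: \<phi>_def)
      qed
      moreover have "lab y \<in> M"
        using y VM labM by blast
      ultimately show ?thesis
        by blast
    qed
    \<comment> \<open>At a point realizing all the \<open>\<phi> n M\<close>, some
      \<open>V n M\<close> contains the point itself, and there the bump has the value 1.\<close>
    obtain x n where "x \<in> M" "x \<in> V n M" "\<phi> n M x = ?ext (\<phi> n M)"
      using realize[of "\<lambda>n. \<phi> n M", OF \<phi>] cover by metis
    then have n: "?ext (\<phi> n M) > 0"
      using bump_ge[of "s n" x "V n M" x, OF s] by (simp add: \<phi>_def)
    have "\<exists>\<alpha>\<in>M. ?ext (\<phi> n {\<alpha>}) > 0"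
    proof (rule nonmeasurable_imp_principal[OF nm, where P = "\<lambda>A. ?ext (\<phi> n A) > 0"])
      fix B :: "nat \<Rightarrow> 'a set"
      \<comment> \<open>Realizing \<open>\<phi> n M\<close> along with the
        \<open>\<phi> n (B k)\<close> puts \<open>x\<close> where \<open>\<phi> n M\<close> is
        positive, which gives \<open>x\<close> a label.\<close>
      define F where "F = case_nat (\<phi> n M) (\<lambda>k. \<phi> n (B k))"
      have "continuous_map mtopology (top_of_set {0..1}) (F k)" for k
        by (auto simp: F_def \<phi> split: nat.splits)
      then obtain x where x: "x \<in> M" "\<And>k. F k x = ?ext (F k)"
        using realize[of F] by blast
      have xM: "\<phi> n M x = ?ext (\<phi> n M)" and xB: "\<And>k. \<phi> n (B k) x = ?ext (\<phi> n (B k))"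
        using x(2)[of 0] x(2)[of "Suc _"] by (simp_all add: F_def)
      obtain \<alpha> where \<alpha>: "\<alpha> \<in> M" "\<And>A. \<phi> n A x = (if \<alpha> \<in> A then \<phi> n M x else 0)"
        using label[OF x(1), of n] xM n by auto
      have "?ext (\<phi> n (B k)) > 0 \<longleftrightarrow> \<alpha> \<in> B k" for k
        unfolding xB[symmetric] \<alpha>(2)[of "B k"] xM using n by simp
      then show "\<exists>a\<in>M. \<forall>k. ?ext (\<phi> n (B k)) > 0 \<longleftrightarrow> a \<in> B k"
        using \<alpha>(1) by blast
    qed
    then obtain \<alpha> where \<alpha>: "\<alpha> \<in> M" "?ext (\<phi> n {\<alpha>}) > 0"
      by blast
    \<comment> \<open>A point \<open>y\<close> of the piece is within \<open>s n\<close> of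
      \<open>x\<close>, and the margin \<open>3 * s n\<close> in \<open>V\<close> extends the
      \<open>r\<close>-ball condition from \<open>y\<close> to \<open>x\<close>.\<close>
    have "d \<alpha> x < r" if "x \<in> M" and pos: "\<phi> n {\<alpha>} x > 0" for x
    proof -
      obtain y where "y \<in> V n {\<alpha>}" "d x y < s n"
        using bump_pos_imp[of "s n" "V n {\<alpha>}" x, OF s] pos by (auto simp: \<phi>_def)
      then show ?thesis
        using \<open>x \<in> M\<close> s[of n] commute[of x y] by (auto simp: V_def)
    qed
    then show ?thesis
      using \<alpha> \<phi> by blast
  qed
  have "\<forall>k::nat. \<exists>\<alpha> \<phi>. \<alpha> \<in> M \<and> continuous_map mtopology (top_of_set {0..1}) \<phi> \<and> ?ext \<phi> > 0
      \<and> (\<forall>x\<in>M. \<phi> x > 0 \<longrightarrow> d \<alpha> x < 1 / Suc k)"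
  proof
    fix k :: nat
    show "\<exists>\<alpha> \<phi>. \<alpha> \<in> M \<and> continuous_map mtopology (top_of_set {0..1}) \<phi> \<and> ?ext \<phi> > 0
      \<and> (\<forall>x\<in>M. \<phi> x > 0 \<longrightarrow> d \<alpha> x < 1 / Suc k)"
      using small[of "1 / Suc k"] by auto
  qed
  then obtain \<alpha> \<phi> where \<alpha>: "\<And>k::nat. \<alpha> k \<in> M"
    and \<phi>: "\<And>k. continuous_map mtopology (top_of_set {0..1}) (\<phi> k)" "\<And>k. ?ext (\<phi> k) > 0"
    and near: "\<And>k x. \<lbrakk>x \<in> M; \<phi> k x > 0\<rbrakk> \<Longrightarrow> d (\<alpha> k) x < 1 / Suc k"
    by metis
  obtain x where x: "x \<in> M" "\<And>k. \<phi> k x = ?ext (\<phi> k)"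
    using realize[of \<phi>, OF \<phi>(1)] by blast
  have "p f = f x" if f: "f \<in> unit_functions mtopology" for f
  proof -
    have fc: "continuous_map mtopology (top_of_set {0..1}) f" and fr: "restrict f M = f"
      using f by (auto simp: unit_functions_def extensional_restrict)
    \<comment> \<open>The point realizing \<open>f\<close> together with all \<open>\<phi> k\<close>
      lies within \<open>2 / (k + 1)\<close> of \<open>x\<close> for every \<open>k\<close>, so it
      is \<open>x\<close>.\<close>
    have "continuous_map mtopology (top_of_set {0..1}) (case_nat f \<phi> k)" for k
      using fc \<phi> by (auto split: nat.splits)
    then obtain y where y: "y \<in> M" "\<And>k. case_nat f \<phi> k y = ?ext (case_nat f \<phi> k)"
      using realize[of "case_nat f \<phi>"] by blast
    have fy: "f y = ?ext f" and \<phi>y: "\<And>k. \<phi> k y = ?ext (\<phi> k)"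
      using y(2)[of 0] y(2)[of "Suc _"] by simp_all
    have "d x y \<le> 0 + e" if "e > 0" for e
    proof -
      obtain k where k: "1 / real (Suc k) < e / 2"
        using nat_approx_posE[of "e/2"] \<open>e > 0\<close> by auto
      have "d x y \<le> d x (\<alpha> k) + d (\<alpha> k) y"
        using x y \<alpha> by (intro triangle) auto
      then show ?thesis
        using near[OF x(1), of k] near[OF y(1), of k] \<phi>(2)[of k] x(2)[of k] \<phi>y[of k] k
        by (simp add: commute[of x])
    qed
    then have "d x y \<le> 0"
      by (rule field_le_epsilon)
    then have "x = y"
      using x(1) y(1) nonneg[of x y] by (simp add: order_antisym)
    then show ?thesis
      using fy fr by (simp add: stone_extension_def)
  qed
  moreover have "p \<in> extensional (unit_functions mtopology)"
    using p by (auto simp: stone_cech_def unit_cube_def PiE_def)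
  ultimately have "p = unit_eval mtopology x"
    by (intro extensionalityI[of _ "unit_functions mtopology"]) (auto simp: unit_eval_def)
  then show "p \<in> unit_eval mtopology ` topspace mtopology"
    using x(1) by simp
qed

end

text \<open>A two-valued measure on \<open>S\<close> has an image under each \<open>\<pi> n\<close>,
  which must have an atom \<open>a n\<close> in \<open>T\<close>. The countably many sets where
  \<open>\<pi> n\<close> is \<open>a n\<close> have full measure, but their intersection has at most
  one point.\<close>

lemma nonmeasurable_if_countably_separated:
  fixes \<pi> :: "nat \<Rightarrow> 'a \<Rightarrow> 'b"
  assumes T: "\<not> measurable_cardinality T"
    and \<pi>: "\<And>n x. x \<in> S \<Longrightarrow> \<pi> n x \<in> T"
    and sep: "\<And>x y. \<lbrakk>x \<in> S; y \<in> S; \<And>n. \<pi> n x = \<pi> n y\<rbrakk> \<Longrightarrow> x = y"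
  shows "\<not> measurable_cardinality S"
proof
  assume "measurable_cardinality S"
  then obtain M :: "'a measure" where M': "space M = S \<and> sets M = Pow S \<and>
      (\<forall>A\<subseteq>S. emeasure M A \<in> {0, 1}) \<and> emeasure M S = 1 \<and> (\<forall>s\<in>S. emeasure M {s} = 0)"
    unfolding measurable_cardinality_def by (rule exE)
  then have M: "space M = S" "sets M = Pow S" and one: "emeasure M S = 1"
    by simp_all
  have two: "emeasure M A \<in> {0, 1}" if "A \<subseteq> S" for A
    using M' that by blast
  have null: "emeasure M {s} = 0" if "s \<in> S" for s
    using M' that by blast
  have "\<exists>a. emeasure M {x \<in> S. \<pi> n x = a} = 1" for n
  proof -
    let ?N = "distr M (count_space T) (\<pi> n)"
    have meas: "\<pi> n \<in> measurable M (count_space T)"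
      using \<pi> by (auto simp: measurable_def M)
    have N: "emeasure ?N A = emeasure M (\<pi> n -` A \<inter> S)" if "A \<subseteq> T" for A
      using emeasure_distr[OF meas] that by (simp add: M)
    have "emeasure ?N A \<in> {0, 1}" if "A \<subseteq> T" for A
      unfolding N[OF that] by (rule two) simp
    moreover have "\<pi> n -` T \<inter> S = S"
      using \<pi> by auto
    then have "emeasure ?N T = 1"
      using N[of T] one by simp
    moreover have "space ?N = T" "sets ?N = Pow T"
      by simp_all
    ultimately have "measurable_cardinality T" if "\<forall>a\<in>T. emeasure ?N {a} = 0"
      unfolding measurable_cardinality_def using that by (intro exI[of _ ?N] conjI allI impI)
    then have "\<not> (\<forall>a\<in>T. emeasure ?N {a} = 0)"
      using T by argo
    then obtain a where a: "a \<in> T" "emeasure ?N {a} \<noteq> 0"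
      by blast
    have "\<pi> n -` {a} \<inter> S = {x \<in> S. \<pi> n x = a}"
      by auto
    then show ?thesis
      using a N[of "{a}"] two[of "{x \<in> S. \<pi> n x = a}"] by auto
  qed
  then obtain a where a: "\<And>n. emeasure M {x \<in> S. \<pi> n x = a n} = 1"
    by metis
  have "S - {x \<in> S. \<pi> n x = a n} \<in> null_sets M" for n
  proof (rule null_setsI)
    have "emeasure M (space M - {x \<in> S. \<pi> n x = a n}) = emeasure M (space M) - emeasure M {x \<in> S. \<pi> n x = a n}"
      by (rule emeasure_compl) (auto simp: M a)
    then show "emeasure M (S - {x \<in> S. \<pi> n x = a n}) = 0"
      by (simp add: M a one)
  qed (simp add: M)
  then have "(\<Union>n. S - {x \<in> S. \<pi> n x = a n}) \<in> null_sets M"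
    by (rule null_sets_UN)
  moreover have "{x \<in> S. \<forall>n. \<pi> n x = a n} \<in> null_sets M"
  proof (cases "{x \<in> S. \<forall>n. \<pi> n x = a n} = {}")
    case True
    show ?thesis
      unfolding True by simp
  next
    case False
    then obtain x where "x \<in> S" "\<And>n. \<pi> n x = a n"
      by blast
    then have "{x \<in> S. \<forall>n. \<pi> n x = a n} = {x}"
      using sep by auto
    then show ?thesis
      using null[OF \<open>x \<in> S\<close>] \<open>x \<in> S\<close> by (auto simp: M intro!: null_setsI)
  qed
  ultimately have "(\<Union>n. S - {x \<in> S. \<pi> n x = a n}) \<union> {x \<in> S. \<forall>n. \<pi> n x = a n} \<in> null_sets M"
    by (rule null_sets.Un)
  moreover have "(\<Union>n. S - {x \<in> S. \<pi> n x = a n}) \<union> {x \<in> S. \<forall>n. \<pi> n x = a n} = S"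
    by auto
  ultimately show False
    using one by (simp add: null_sets_def)
qed

section \<open>The space of step functions\<close>

text \<open>For fixed \<open>q\<close> the points \<open>t < q\<close> with \<open>{t..<q}\<close>
  inside \<open>U\<close> form an interval, and rational \<open>q\<close> suffice to exhaust
  \<open>U\<close>.\<close>

lemma right_open_imp_borel:
  fixes U :: "real set"
  assumes "\<And>t. t \<in> U \<Longrightarrow> \<exists>e>0. {t..<t+e} \<subseteq> U"
  shows "U \<in> sets borel"
proof -
  define I where "I q = {t. t < q \<and> {t..<q} \<subseteq> U}" for q
  have "is_interval (I q)" for q
    unfolding is_interval_1 I_def by fastforce
  then have "(\<Union>q\<in>\<rat>. I q) \<in> sets borel"
    by (intro sets.countable_UN'[OF countable_rat] image_subsetI real_interval_borel_measurable)
  moreover have "(\<Union>q\<in>\<rat>. I q) = U"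
  proof (intro equalityI subsetI)
    fix t assume "t \<in> U"
    then obtain e where e: "e > 0" "{t..<t+e} \<subseteq> U"
      using assms by blast
    then obtain q where "q \<in> \<rat>" "t < q" "q < t + e"
      using Rats_dense_in_real[of t "t + e"] by auto
    then show "t \<in> (\<Union>q\<in>\<rat>. I q)"
      using e by (auto simp: I_def intro!: bexI[of _ q])
  qed (auto simp: I_def)
  ultimately show ?thesis
    by simp
qed

text \<open>
  Step functions (which may have infinitely many steps) live on \<open>[0,1)\<close>. Outside
  they repeat the value at \<open>0\<close>, which makes them determined by their values on \<open>[0,1)\<close> and keeps the action of a group on them pointwise.
\<close>

definition clamp_unit :: "real \<Rightarrow> real" where
  "clamp_unit s = (if s \<in> {0..<1} then s else 0)"

definition step_functions :: "'a set \<Rightarrow> (real \<Rightarrow> 'a) set" where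
  "step_functions A = {f. range f \<subseteq> A \<and> (\<forall>s. f (clamp_unit s) = f s)
     \<and> (\<forall>t\<in>{0..<1}. \<exists>e>0. \<forall>s\<in>{t..<t+e}. s < 1 \<longrightarrow> f s = f t)}"

definition step_dist :: "(real \<Rightarrow> 'a) \<Rightarrow> (real \<Rightarrow> 'a) \<Rightarrow> real" where
  "step_dist f h = measure lborel {t \<in> {0..<1}. f t \<noteq> h t}"

text \<open>Comparing \<open>clamp_unit s\<close> with \<open>c\<close> makes the result repeat its
  value at 0 outside \<open>{0..<1}\<close>, as step functions must.\<close>

definition splice :: "real \<Rightarrow> (real \<Rightarrow> 'a) \<Rightarrow> (real \<Rightarrow> 'a) \<Rightarrow> real \<Rightarrow> 'a" where
  "splice c f h = (\<lambda>s. if clamp_unit s < c then f s else h s)"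

lemma clamp_unit_range [simp]: "clamp_unit s \<in> {0..<1}" "clamp_unit (clamp_unit s) = clamp_unit s"
  by (auto simp: clamp_unit_def)

lemma step_functions_eqI:
  assumes "f \<in> step_functions A" "h \<in> step_functions B" "\<And>t. t \<in> {0..<1} \<Longrightarrow> f t = h t"
  shows "f = h"
proof
  fix s
  show "f s = h s"
    using assms(3)[OF clamp_unit_range(1)[of s]] assms(1,2) by (simp add: step_functions_def)
qed

lemma step_functions_rightD:
  assumes "f \<in> step_functions A" "t \<in> {0..<1}"
  obtains e where "e > 0" "t + e \<le> 1" "\<And>s. s \<in> {t..<t+e} \<Longrightarrow> f s = f t"
proof -
  obtain e where "e > 0" "\<forall>s\<in>{t..<t+e}. s < 1 \<longrightarrow> f s = f t"
    using assms unfolding step_functions_def by blast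
  show ?thesis
  proof (rule that)
    show "min e (1 - t) > 0" "t + min e (1 - t) \<le> 1"
      using \<open>e > 0\<close> assms(2) by auto
    show "f s = f t" if "s \<in> {t..<t + min e (1 - t)}" for s
    proof -
      have "s \<in> {t..<t+e}" "s < 1"
        using that by auto
      then show ?thesis
        using \<open>\<forall>s\<in>{t..<t+e}. s < 1 \<longrightarrow> f s = f t\<close> by blast
    qed
  qed
qed

lemma const_in_step_functions:
  assumes "a \<in> A"
  shows "(\<lambda>_. a) \<in> step_functions A"
proof -
  have "\<exists>e>0::real. True"
    by (rule exI[of _ 1]) simp
  then show ?thesis
    using assms by (simp add: step_functions_def image_subset_iff)
qed

lemma fmeasurable_lborel_Ico: "{a..<b::real} \<in> fmeasurable lborel"
  by (cases "a \<le> b") (auto intro!: fmeasurableI)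

lemma fmeasurable_unit_subset:
  assumes "A \<in> sets borel" "A \<subseteq> {0..<1::real}"
  shows "A \<in> fmeasurable lborel"
  by (rule fmeasurableI2[OF fmeasurable_lborel_Ico assms(2)]) (use assms in auto)

text \<open>This serves twice: it makes the set of disagreement Borel, and it gives this set
  positive measure unless it is empty.\<close>

lemma step_dist_set_right_open:
  assumes "f \<in> step_functions A" "h \<in> step_functions B" "t \<in> {t \<in> {0..<1}. f t \<noteq> h t}"
  shows "\<exists>e>0. {t..<t+e} \<subseteq> {t \<in> {0..<1}. f t \<noteq> h t}"
proof -
  have t: "t \<in> {0..<1}" "f t \<noteq> h t"
    using assms(3) by auto
  obtain e where e: "e > 0" "t + e \<le> 1" "\<And>s. s \<in> {t..<t+e} \<Longrightarrow> f s = f t"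
    using step_functions_rightD[OF assms(1) t(1)] by blast
  obtain e' where e': "e' > 0" "t + e' \<le> 1" "\<And>s. s \<in> {t..<t+e'} \<Longrightarrow> h s = h t"
    using step_functions_rightD[OF assms(2) t(1)] by blast
  have "{t..<t + min e e'} \<subseteq> {t \<in> {0..<1}. f t \<noteq> h t}"
  proof
    fix s assume s: "s \<in> {t..<t + min e e'}"
    then have "f s = f t" "h s = h t" "s \<in> {0..<1}"
      using t(1) e(2) by (auto intro!: e(3) e'(3))
    then show "s \<in> {t \<in> {0..<1}. f t \<noteq> h t}"
      using t(2) by simp
  qed
  then show ?thesis
    using e(1) e'(1) by (intro exI[of _ "min e e'"]) auto
qed

lemma step_dist_set_fmeasurable:
  assumes "f \<in> step_functions A" "h \<in> step_functions B"
  shows "{t \<in> {0..<1}. f t \<noteq> h t} \<in> fmeasurable lborel"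
  by (rule fmeasurable_unit_subset[OF right_open_imp_borel])
     (use step_dist_set_right_open[OF assms] in auto)

lemma Metric_space_step_functions: "Metric_space (step_functions A) step_dist"
proof
  fix f h k :: "real \<Rightarrow> 'a"
  show "0 \<le> step_dist f h"
    by (simp add: step_dist_def)
  show "step_dist f h = step_dist h f"
    by (simp add: step_dist_def eq_commute)
  assume f: "f \<in> step_functions A" and h: "h \<in> step_functions A"
  show "step_dist f h = 0 \<longleftrightarrow> f = h"
  proof
    assume zero: "step_dist f h = 0"
    show "f = h"
    proof (rule step_functions_eqI[OF f h], rule ccontr)
      fix t :: real assume "t \<in> {0..<1}" "f t \<noteq> h t"
      then obtain e where e: "e > 0" "{t..<t+e} \<subseteq> {t \<in> {0..<1}. f t \<noteq> h t}"
        using step_dist_set_right_open[OF f h, of t] by auto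
      then have "measure lborel {t..<t+e} \<le> step_dist f h"
        unfolding step_dist_def by (intro measure_mono_fmeasurable step_dist_set_fmeasurable[OF f h]) auto
      then show False
        using zero e(1) by simp
    qed
  qed (simp add: step_dist_def)
  assume k: "k \<in> step_functions A"
  have "step_dist f k \<le> measure lborel ({t \<in> {0..<1}. f t \<noteq> h t} \<union> {t \<in> {0..<1}. h t \<noteq> k t})"
    unfolding step_dist_def
    by (intro measure_mono_fmeasurable fmeasurable.Un step_dist_set_fmeasurable[OF f h]
        step_dist_set_fmeasurable[OF h k] fmeasurableD step_dist_set_fmeasurable[OF f k]) auto
  also have "\<dots> \<le> step_dist f h + step_dist h k"
    unfolding step_dist_def
    by (intro measure_Un_le fmeasurableD step_dist_set_fmeasurable[OF f h] step_dist_set_fmeasurable[OF h k])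
  finally show "step_dist f k \<le> step_dist f h + step_dist h k" .
qed

section \<open>Deforming step functions by splicing\<close>

lemma splice_0: "splice 0 f h = h"
  by (rule ext) (simp add: splice_def clamp_unit_def)

lemma splice_1: "splice 1 f h = f"
  by (rule ext) (simp add: splice_def clamp_unit_def)

lemma splice_in_step_functions:
  assumes f: "f \<in> step_functions A" and h: "h \<in> step_functions A"
  shows "splice c f h \<in> step_functions A"
proof -
  have "\<exists>e>0. \<forall>s\<in>{t..<t+e}. s < 1 \<longrightarrow> splice c f h s = splice c f h t" if t: "t \<in> {0..<1}" for t
  proof -
    obtain e where e: "e > 0" "t + e \<le> 1" "\<And>s. s \<in> {t..<t+e} \<Longrightarrow> f s = f t"
      using step_functions_rightD[OF f t] by blast
    obtain e' where e': "e' > 0" "t + e' \<le> 1" "\<And>s. s \<in> {t..<t+e'} \<Longrightarrow> h s = h t"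
      using step_functions_rightD[OF h t] by blast
    show ?thesis
    proof (cases "t < c")
      case True
      have "splice c f h s = splice c f h t" if "s \<in> {t..<t + min e (c - t)}" for s
      proof -
        have "t \<le> s" "s < t + e" "s < c"
          using that by (auto simp: min_def split: if_splits)
        then show ?thesis
          using e(2) e(3)[of s] t True by (simp add: splice_def clamp_unit_def)
      qed
      moreover have "min e (c - t) > 0"
        using e(1) True by simp
      ultimately show ?thesis
        by blast
    next
      case False
      have "splice c f h s = splice c f h t" if "s \<in> {t..<t + e'}" for s
        using e'(2) e'(3)[of s] that t False by (simp add: splice_def clamp_unit_def)
      then show ?thesis
        using e'(1) by blast
    qed
  qed
  moreover have "splice c f h (clamp_unit s) = splice c f h s" for s
    using f h by (simp add: splice_def step_functions_def)
  moreover have "range (splice c f h) \<subseteq> A"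
    using f h by (auto simp: splice_def step_functions_def)
  ultimately show ?thesis
    by (simp add: step_functions_def)
qed

text \<open>Two splices can differ only where \<open>f\<close> and \<open>f'\<close> differ, where
  \<open>h\<close> and \<open>h'\<close> differ, or between \<open>c\<close> and
  \<open>c'\<close>.\<close>

lemma step_dist_splice_le:
  assumes "f \<in> step_functions A" "h \<in> step_functions A" "f' \<in> step_functions A" "h' \<in> step_functions A"
  shows "step_dist (splice c f h) (splice c' f' h') \<le> step_dist f f' + step_dist h h' + \<bar>c - c'\<bar>"
proof -
  let ?F = "{t \<in> {0..<1}. f t \<noteq> f' t}" and ?H = "{t \<in> {0..<1}. h t \<noteq> h' t}"
    and ?C = "{min c c'..<max c c'}"
  have meas: "?F \<in> fmeasurable lborel" "?H \<in> fmeasurable lborel" "?C \<in> fmeasurable lborel"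
    by (intro step_dist_set_fmeasurable[OF assms(1,3)] step_dist_set_fmeasurable[OF assms(2,4)]
        fmeasurable_lborel_Ico)+
  have "step_dist (splice c f h) (splice c' f' h') \<le> measure lborel (?F \<union> ?H \<union> ?C)"
    unfolding step_dist_def
  proof (rule measure_mono_fmeasurable)
    show "{t \<in> {0..<1}. splice c f h t \<noteq> splice c' f' h' t} \<subseteq> ?F \<union> ?H \<union> ?C"
      by (auto simp: splice_def clamp_unit_def split: if_splits)
    show "{t \<in> {0..<1}. splice c f h t \<noteq> splice c' f' h' t} \<in> sets lborel"
      by (intro fmeasurableD step_dist_set_fmeasurable[where A = A and B = A]
          splice_in_step_functions assms)
  qed (intro fmeasurable.Un meas)
  also have "\<dots> \<le> measure lborel (?F \<union> ?H) + measure lborel ?C"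
    by (intro measure_Un_le fmeasurableD fmeasurable.Un meas)
  also have "\<dots> \<le> measure lborel ?F + measure lborel ?H + measure lborel ?C"
    by (intro add_right_mono measure_Un_le fmeasurableD meas)
  also have "measure lborel ?C = \<bar>c - c'\<bar>"
    by (simp add: min_def max_def)
  finally show ?thesis
    by (simp add: step_dist_def)
qed

context Metric_space
begin

lemma continuous_map_imp_mball:
  assumes "continuous_map X mtopology f" "x \<in> topspace X" "e > 0"
  shows "\<exists>U. openin X U \<and> x \<in> U \<and> (\<forall>y\<in>U. f y \<in> mball (f x) e)"
  using assms(1)[unfolded continuous_map_to_metric] assms(2,3) by simp

end

text \<open>This is contractibility in parametrized form: letting \<open>c\<close> run from 0 to 1
  deforms \<open>h\<close> into \<open>f\<close>.\<close>

lemma continuous_map_splice: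
  assumes c: "continuous_map Z euclideanreal c"
    and f: "continuous_map Z (Metric_space.mtopology (step_functions A) step_dist) f"
    and h: "continuous_map Z (Metric_space.mtopology (step_functions A) step_dist) h"
  shows "continuous_map Z (Metric_space.mtopology (step_functions A) step_dist) (\<lambda>z. splice (c z) (f z) (h z))"
proof -
  interpret Metric_space "step_functions A" step_dist
    by (rule Metric_space_step_functions)
  have c': "continuous_map Z Met_TC.mtopology c"
    using c by simp
  show ?thesis
    unfolding continuous_map_to_metric
  proof (intro ballI allI impI)
    fix z and e :: real
    assume z: "z \<in> topspace Z" and "e > 0"
    then have e3: "e / 3 > 0"
      by simp
    obtain U where U: "openin Z U" "z \<in> U" "\<And>y. y \<in> U \<Longrightarrow> dist (c z) (c y) < e / 3"
      using Met_TC.continuous_map_imp_mball[OF c' z e3] by (auto simp: Met_TC.in_mball)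
    obtain V where V: "openin Z V" "z \<in> V" "\<And>y. y \<in> V \<Longrightarrow> f y \<in> mball (f z) (e / 3)"
      using continuous_map_imp_mball[OF f z e3] by blast
    obtain W where W: "openin Z W" "z \<in> W" "\<And>y. y \<in> W \<Longrightarrow> h y \<in> mball (h z) (e / 3)"
      using continuous_map_imp_mball[OF h z e3] by blast
    have "splice (c y) (f y) (h y) \<in> mball (splice (c z) (f z) (h z)) e" if "y \<in> U \<inter> V \<inter> W" for y
    proof -
      have "dist (c z) (c y) < e / 3" "f y \<in> mball (f z) (e / 3)" "h y \<in> mball (h z) (e / 3)"
        using that U(3) V(3) W(3) by auto
      then show ?thesis
        using step_dist_splice_le[of "f z" A "h z" "f y" "h y" "c z" "c y"]
        by (auto simp: splice_in_step_functions dist_real_def)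
    qed
    then show "\<exists>U. openin Z U \<and> z \<in> U \<and> (\<forall>y\<in>U. splice (c y) (f y) (h y) \<in> mball (splice (c z) (f z) (h z)) e)"
      using U V W by (intro exI[of _ "U \<inter> V \<inter> W"]) auto
  qed
qed

section \<open>Lifting along metric coverings\<close>

text \<open>A covering map with uniform constants: \<open>lift_near\<close> plays the role of local
  sections, and \<open>fibre_separated\<close> keeps the sheets apart by the same distance
  everywhere.\<close>

locale metric_covering =
  E: Metric_space E d + B: Metric_space B D
  for E :: "'e set" and d and B :: "'b set" and D +
  fixes proj :: "'e \<Rightarrow> 'b"
  assumes proj_in: "x \<in> E \<Longrightarrow> proj x \<in> B"
    and proj_contracts: "\<lbrakk>x \<in> E; y \<in> E\<rbrakk> \<Longrightarrow> D (proj x) (proj y) \<le> d x y"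
    and lift_near: "\<lbrakk>x \<in> E; b \<in> B; D (proj x) b < r\<rbrakk> \<Longrightarrow> \<exists>y\<in>E. proj y = b \<and> d x y < r"
    and fibre_separated: "\<lbrakk>x \<in> E; y \<in> E; proj x = proj y; d x y < 1\<rbrakk> \<Longrightarrow> x = y"
begin

lemma continuous_map_proj: "continuous_map E.mtopology B.mtopology proj"
  unfolding E.metric_continuous_map[OF B.Metric_space_axioms]
proof (intro conjI ballI allI impI)
  fix a and e :: real assume "a \<in> E" "e > 0"
  then show "\<exists>\<delta>>0. \<forall>x. x \<in> E \<and> d a x < \<delta> \<longrightarrow> D (proj a) (proj x) < e"
    using proj_contracts by (intro exI[of _ e]) (auto intro: le_less_trans)
qed (use proj_in in auto)

text \<open>The distance of the two lifts is continuous on a connected set, vanishes at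
  \<open>a\<close> and omits the value 1/2.\<close>

lemma lift_unique:
  assumes F: "continuous_map (top_of_set T) E.mtopology F"
    and F': "continuous_map (top_of_set T) E.mtopology F'"
    and eq: "\<And>t. t \<in> T \<Longrightarrow> proj (F t) = proj (F' t)"
    and T: "connected T" "a \<in> T" "F a = F' a" "t \<in> T"
  shows "F t = F' t"
proof (rule ccontr)
  assume ne: "F t \<noteq> F' t"
  have in_E: "F s \<in> E" "F' s \<in> E" if "s \<in> T" for s
    using F F' that by (auto simp: continuous_map_def)
  have "continuous_map (top_of_set T) euclidean (\<lambda>s. d (F s) (F' s))"
    using continuous_map_mdist[of "top_of_set T" "metric (E, d)" F F'] F F'
    by (simp add: E.mtopology_of)
  then have "connected ((\<lambda>s. d (F s) (F' s)) ` T)"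
    using T(1) by (intro connected_continuous_image) auto
  moreover have "0 \<in> (\<lambda>s. d (F s) (F' s)) ` T"
    using T(2,3) in_E by (auto intro!: image_eqI[of _ _ a])
  moreover have "d (F t) (F' t) \<in> (\<lambda>s. d (F s) (F' s)) ` T"
    using T(4) by blast
  moreover have "1/2 \<le> d (F t) (F' t)"
    using fibre_separated[OF in_E[OF T(4)] eq[OF T(4)]] ne by linarith
  ultimately have "1/2 \<in> (\<lambda>s. d (F s) (F' s)) ` T"
    by (meson connectedD_interval half_gt_zero less_imp_le zero_less_one)
  then obtain s where s: "s \<in> T" "d (F s) (F' s) = 1/2"
    by (auto simp: image_iff)
  then have "F s = F' s"
    using fibre_separated[OF in_E[OF s(1)] eq[OF s(1)]] by simp
  then show False
    using s in_E by simp
qed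

text \<open>Different points of a fibre are at least 1 apart, so the point over \<open>v z\<close>
  within 1/4 of \<open>F z\<close> is unique, and this forces the pointwise choice to be
  continuous.\<close>

lemma lift_of_near_map:
  assumes F: "continuous_map Z E.mtopology F" and v: "continuous_map Z B.mtopology v"
    and near: "\<And>z. z \<in> topspace Z \<Longrightarrow> D (proj (F z)) (v z) < 1/4"
  shows "\<exists>F'. continuous_map Z E.mtopology F' \<and>
    (\<forall>z\<in>topspace Z. proj (F' z) = v z \<and> d (F z) (F' z) < 1/4)"
proof -
  have FE: "F z \<in> E" and vB: "v z \<in> B" if "z \<in> topspace Z" for z
    using F v that by (auto simp: continuous_map_def)
  define F' where "F' z = (SOME y. y \<in> E \<and> proj y = v z \<and> d (F z) y < 1/4)" for z
  have F': "F' z \<in> E" "proj (F' z) = v z" "d (F z) (F' z) < 1/4" if "z \<in> topspace Z" for z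
  proof -
    have "\<exists>y. y \<in> E \<and> proj y = v z \<and> d (F z) y < 1/4"
      using lift_near[OF FE[OF that] vB[OF that] near[OF that]] by blast
    then have "F' z \<in> E \<and> proj (F' z) = v z \<and> d (F z) (F' z) < 1/4"
      unfolding F'_def by (rule someI_ex)
    then show "F' z \<in> E" "proj (F' z) = v z" "d (F z) (F' z) < 1/4"
      by blast+
  qed
  have "continuous_map Z E.mtopology F'"
    unfolding E.continuous_map_to_metric
  proof (intro ballI allI impI)
    fix z and e :: real
    assume z: "z \<in> topspace Z" and "e > 0"
    define r where "r = min e (1/4)"
    have "r > 0"
      using \<open>e > 0\<close> by (simp add: r_def)
    obtain U where U: "openin Z U" "z \<in> U" "\<And>y. y \<in> U \<Longrightarrow> F y \<in> E.mball (F z) r"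
      using E.continuous_map_imp_mball[OF F z \<open>r > 0\<close>] by blast
    obtain V where V: "openin Z V" "z \<in> V" "\<And>y. y \<in> V \<Longrightarrow> v y \<in> B.mball (v z) r"
      using B.continuous_map_imp_mball[OF v z \<open>r > 0\<close>] by blast
    have "F' y \<in> E.mball (F' z) e" if y: "y \<in> U \<inter> V" for y
    proof -
      have yZ: "y \<in> topspace Z"
        using y openin_subset[OF U(1)] by blast
      have "D (proj (F' z)) (v y) < r"
        using V(3)[of y] y by (simp add: F'(2)[OF z])
      then obtain w where w: "w \<in> E" "proj w = v y" "d (F' z) w < r"
        using lift_near[OF F'(1)[OF z] vB[OF yZ]] by blast
      \<comment> \<open>The route from \<open>F' y\<close> through \<open>F y\<close>,
        \<open>F z\<close> and \<open>F' z\<close> to \<open>w\<close> has four parts below 1/4, so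
        its ends, which lie in one fibre, coincide.\<close>
      have "d (F' y) w \<le> d (F' y) (F y) + d (F y) w"
        "d (F y) w \<le> d (F y) (F z) + d (F z) w" "d (F z) w \<le> d (F z) (F' z) + d (F' z) w"
        using F'(1) FE w z yZ by (auto intro!: E.triangle)
      moreover have "d (F' y) (F y) < 1/4" "d (F z) (F' z) < 1/4" "d (F y) (F z) < r" "r \<le> 1/4"
        using F'(3)[OF yZ] F'(3)[OF z] U(3)[of y] y by (auto simp: E.commute r_def)
      ultimately have "F' y = w"
        using w F'(1,2)[OF yZ] by (intro fibre_separated) auto
      then show ?thesis
        using w F'(1)[OF z] by (simp add: r_def)
    qed
    then show "\<exists>U. openin Z U \<and> z \<in> U \<and> (\<forall>y\<in>U. F' y \<in> E.mball (F' z) e)"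
      using U V by (intro exI[of _ "U \<inter> V"]) auto
  qed
  then show ?thesis
    using F' by blast
qed

text \<open>Compact sets that are star-shaped about 0 include the interval and the square, so paths
  and homotopies are lifted by one argument.\<close>

lemma lift_exists:
  fixes T :: "'t::real_normed_vector set"
  assumes T: "compact T" "0 \<in> T" and star: "\<And>t c. \<lbrakk>t \<in> T; c \<in> {0..1}\<rbrakk> \<Longrightarrow> c *\<^sub>R t \<in> T"
    and u: "continuous_map (top_of_set T) B.mtopology u" and a: "a \<in> E" "proj a = u 0"
  obtains F where "continuous_map (top_of_set T) E.mtopology F" "F 0 = a" "\<And>t. t \<in> T \<Longrightarrow> proj (F t) = u t"
proof -
  \<comment> \<open>Lift \<open>t \<mapsto> u (k/N t)\<close> for \<open>k = 0, \<dots>, N\<close>, with \<open>N\<close> so large that consecutive maps are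
    uniformly \<open>1/4\<close>-close.\<close>
  have "uniformly_continuous_map (submetric euclidean_metric T) (metric (B, D)) u"
    using T(1) u
    by (intro continuous_imp_uniformly_continuous_map)
       (simp add: B.mtopology_of mtopology_of_submetric compact_space_subtopology)
  then obtain \<delta> where "\<delta> > 0" and \<delta>: "\<And>s t. \<lbrakk>s \<in> T; t \<in> T; dist t s < \<delta>\<rbrakk> \<Longrightarrow> D (u t) (u s) < 1/4"
    unfolding uniformly_continuous_map_def
    by (auto dest!: spec[of _ "1/4::real"])
  obtain R where R: "R > 0" "\<And>t. t \<in> T \<Longrightarrow> norm t \<le> R"
    using compact_imp_bounded[OF T(1)] bounded_pos by blast
  obtain N :: nat where N: "R / \<delta> < real N"
    using reals_Archimedean2 by blast
  then have "N > 0"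
    using R(1) \<open>\<delta> > 0\<close> by (cases "N = 0") (auto simp: divide_less_0_iff)
  define v where "v k t = u ((real k / real N) *\<^sub>R t)" for k t
  have v: "continuous_map (top_of_set T) B.mtopology (v k)" if "k \<le> N" for k
  proof -
    have "continuous_map (top_of_set T) (top_of_set T) (\<lambda>t. (real k / real N) *\<^sub>R t)"
      using star that \<open>N > 0\<close> by (auto intro!: continuous_intros)
    from continuous_map_compose[OF this u] show ?thesis
      by (simp add: v_def[abs_def] o_def)
  qed
  have "k \<le> N \<Longrightarrow> \<exists>F. continuous_map (top_of_set T) E.mtopology F \<and> F 0 = a \<and> (\<forall>t\<in>T. proj (F t) = v k t)" for k
  proof (induction k)
    case 0
    then show ?case
      using a by (intro exI[of _ "\<lambda>_. a"]) (auto simp: v_def)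
  next
    case (Suc k)
    then obtain F where F: "continuous_map (top_of_set T) E.mtopology F" "F 0 = a"
      "\<And>t. t \<in> T \<Longrightarrow> proj (F t) = v k t"
      by auto
    have "D (proj (F t)) (v (Suc k) t) < 1/4" if "t \<in> T" for t
    proof -
      have "dist ((real k / real N) *\<^sub>R t) ((real (Suc k) / real N) *\<^sub>R t) = norm t / real N"
        by (simp add: dist_norm diff_divide_distrib[symmetric] flip: scaleR_diff_left)
      also have "\<dots> \<le> R / real N"
        using R(2)[OF that] by (simp add: divide_right_mono)
      also have "\<dots> < \<delta>"
        using N \<open>N > 0\<close> \<open>\<delta> > 0\<close> by (simp add: field_simps)
      finally show ?thesis
        using \<delta>[of "(real (Suc k) / real N) *\<^sub>R t" "(real k / real N) *\<^sub>R t"]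
          star[OF that, of "real k / real N"] star[OF that, of "real (Suc k) / real N"] Suc.prems
        by (simp add: v_def F(3)[OF that])
    qed
    then obtain F' where F': "continuous_map (top_of_set T) E.mtopology F'"
      "\<And>t. t \<in> T \<Longrightarrow> proj (F' t) = v (Suc k) t" "\<And>t. t \<in> T \<Longrightarrow> d (F t) (F' t) < 1/4"
      using lift_of_near_map[OF F(1) v[OF Suc.prems]] by auto
    have "F' 0 \<in> E"
      using F'(1) T(2) by (auto simp: continuous_map_def)
    moreover have "proj (F' 0) = proj a"
      using F'(2)[OF T(2)] a(2) by (simp add: v_def)
    ultimately have "F' 0 = a"
      using fibre_separated[OF a(1), of "F' 0"] F'(3)[OF T(2)] F(2) by simp
    then show ?case
      using F' by blast
  qed
  from this[of N] show ?thesis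
    using that \<open>N > 0\<close> by (auto simp: v_def)
qed

end

section \<open>The classifying space of a group and its compactification\<close>

text \<open>This separates the passage to classes from the topology: what remains is a
  multiplicative function on loops that classifies them up to homotopy.\<close>

lemma fundamental_group_iso:
  assumes in_G: "\<And>p. p \<in> loops K x0 \<Longrightarrow> e p \<in> carrier G"
    and surj: "\<And>g. g \<in> carrier G \<Longrightarrow> \<exists>p\<in>loops K x0. e p = g"
    and join: "\<And>p q. \<lbrakk>p \<in> loops K x0; q \<in> loops K x0\<rbrakk> \<Longrightarrow> e (loop_join p q) = e p \<otimes>\<^bsub>G\<^esub> e q"
    and inj: "\<And>p q. \<lbrakk>p \<in> loops K x0; q \<in> loops K x0\<rbrakk> \<Longrightarrow> (p, q) \<in> loop_homotopy K x0 \<longleftrightarrow> e p = e q"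
  shows "fundamental_group K x0 \<cong> G"
proof -
  let ?R = "loop_homotopy K x0" and ?L = "loops K x0"
  note equiv = equiv_loop_homotopy[of K x0]
  have R_loops: "p \<in> ?L" "q \<in> ?L" if "(p, q) \<in> ?R" for p q
    using equiv that by (auto simp: equiv_def)
  have R_self: "(p, p) \<in> ?R" if "p \<in> ?L" for p
    using inj[OF that that] by simp
  \<comment> \<open>The function \<open>e\<close> is constant on each class, so its image of a class
    is a singleton.\<close>
  define \<phi> where "\<phi> C = the_elem (e ` C)" for C
  have \<phi>: "\<phi> (?R `` {p}) = e p" if p: "p \<in> ?L" for p
  proof -
    have "e q = e p" if "q \<in> ?R `` {p}" for q
      using that inj[of p q] R_loops[of p q] by auto
    moreover have "p \<in> ?R `` {p}"
      using R_self[OF p] by simp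
    ultimately have "e ` (?R `` {p}) = {e p}"
      by blast
    then show ?thesis
      by (simp add: \<phi>_def)
  qed
  have join_loop: "loop_join p q \<in> ?L" if "p \<in> ?L" "q \<in> ?L" for p q
    using loop_join_respects[OF R_self[OF that(1)] R_self[OF that(2)]] by (rule R_loops)
  have mult: "?R `` {p} \<otimes>\<^bsub>fundamental_group K x0\<^esub> ?R `` {q} = ?R `` {loop_join p q}"
    if p: "p \<in> ?L" and q: "q \<in> ?L" for p q
  proof -
    have "?R `` {loop_join p' q'} = ?R `` {loop_join p q}" if "p' \<in> ?R `` {p}" "q' \<in> ?R `` {q}" for p' q'
      using equiv_class_eq[OF equiv loop_join_respects[of p p' K x0 q q']] that by simp
    moreover have "p \<in> ?R `` {p}" "q \<in> ?R `` {q}"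
      using R_self p q by auto
    ultimately have "(\<Union>p'\<in>?R `` {p}. \<Union>q'\<in>?R `` {q}. ?R `` {loop_join p' q'}) = ?R `` {loop_join p q}"
      by blast
    then show ?thesis
      by (simp only: fundamental_group_def monoid.simps)
  qed
  have carrier: "carrier (fundamental_group K x0) = ?L // ?R"
    by (simp add: fundamental_group_def)
  have "\<phi> \<in> hom (fundamental_group K x0) G"
  proof (rule homI)
    fix C assume "C \<in> carrier (fundamental_group K x0)"
    then obtain p where "p \<in> ?L" "C = ?R `` {p}"
      unfolding carrier by (rule quotientE)
    then show "\<phi> C \<in> carrier G"
      using \<phi> in_G by simp
  next
    fix C C' assume "C \<in> carrier (fundamental_group K x0)" "C' \<in> carrier (fundamental_group K x0)"
    then obtain p q where "p \<in> ?L" "C = ?R `` {p}" "q \<in> ?L" "C' = ?R `` {q}"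
      unfolding carrier by (metis quotientE)
    then show "\<phi> (C \<otimes>\<^bsub>fundamental_group K x0\<^esub> C') = \<phi> C \<otimes>\<^bsub>G\<^esub> \<phi> C'"
      by (simp add: mult \<phi> join join_loop)
  qed
  moreover have "inj_on \<phi> (?L // ?R)"
  proof (rule inj_onI)
    fix C C' assume "C \<in> ?L // ?R" "C' \<in> ?L // ?R" and eq: "\<phi> C = \<phi> C'"
    then obtain p q where "p \<in> ?L" "C = ?R `` {p}" "q \<in> ?L" "C' = ?R `` {q}"
      by (metis quotientE)
    then show "C = C'"
      using eq inj[of p q] equiv_class_eq[OF equiv, of p q] by (simp add: \<phi>)
  qed
  moreover have "\<phi> ` (?L // ?R) = carrier G"
  proof (intro equalityI subsetI)
    fix g assume "g \<in> \<phi> ` (?L // ?R)"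
    then show "g \<in> carrier G"
      using \<phi> in_G by (auto elim!: quotientE)
  next
    fix g assume "g \<in> carrier G"
    then obtain p where "p \<in> ?L" "e p = g"
      using surj by blast
    then show "g \<in> \<phi> ` (?L // ?R)"
      using \<phi> by (intro image_eqI[of _ _ "?R `` {p}"]) (auto intro: quotientI)
  qed
  ultimately have "\<phi> \<in> iso (fundamental_group K x0) G"
    by (simp add: iso_def bij_betw_def carrier)
  then show ?thesis
    by (rule is_isoI)
qed

section \<open>The action of the group on step functions and the quotient metric\<close>

context group
begin

definition translate :: "'a \<Rightarrow> (real \<Rightarrow> 'a) \<Rightarrow> real \<Rightarrow> 'a" where
  "translate g f = (\<lambda>s. g \<otimes> f s)"

text \<open>
  The value \<open>0\<close> off the step functions makes the distance symmetric without side conditions, as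
  \<^locale>\<open>Metric_space\<close> demands.
\<close>

definition orbit_dist :: "(real \<Rightarrow> 'a) \<Rightarrow> (real \<Rightarrow> 'a) \<Rightarrow> real" where
  "orbit_dist f h =
     (if f \<in> step_functions (carrier G) \<and> h \<in> step_functions (carrier G)
      then INF g\<in>carrier G. step_dist (translate g f) h else 0)"

text \<open>
  Every orbit contains exactly one function with value \<open>\<one>\<close> at \<open>0\<close>; these functions represent the
  quotient of the step functions by the group.
\<close>

definition based_step_functions :: "(real \<Rightarrow> 'a) set" where
  "based_step_functions = {f \<in> step_functions (carrier G). f 0 = \<one>}"

text \<open>In terms of these representatives this is the quotient map by the group, which becomes
  the covering projection.\<close>

definition normalize :: "(real \<Rightarrow> 'a) \<Rightarrow> real \<Rightarrow> 'a" where
  "normalize f = translate (inv (f 0)) f"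

lemma step_function_closed: "f \<in> step_functions (carrier G) \<Longrightarrow> f s \<in> carrier G"
  by (auto simp: step_functions_def)

lemma translate_closed:
  assumes g: "g \<in> carrier G" and f: "f \<in> step_functions (carrier G)"
  shows "translate g f \<in> step_functions (carrier G)"
proof -
  have "\<exists>e>0. \<forall>s\<in>{t..<t+e}. s < 1 \<longrightarrow> translate g f s = translate g f t" if "t \<in> {0..<1}" for t
    using f that unfolding step_functions_def translate_def mem_Collect_eq by metis
  moreover have "translate g f (clamp_unit s) = translate g f s" for s
    using f by (simp add: step_functions_def translate_def)
  moreover have "range (translate g f) \<subseteq> carrier G"
    using g step_function_closed[OF f] by (auto simp: translate_def)
  ultimately show ?thesis
    by (simp add: step_functions_def)
qed

lemma translate_translate:
  assumes "g \<in> carrier G" "h \<in> carrier G" "f \<in> step_functions (carrier G)"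
  shows "translate g (translate h f) = translate (g \<otimes> h) f"
  using assms step_function_closed[OF assms(3)] by (simp add: translate_def m_assoc)

lemma translate_one: "f \<in> step_functions (carrier G) \<Longrightarrow> translate \<one> f = f"
  using step_function_closed by (simp add: translate_def)

lemma translate_inv_cancel:
  assumes "g \<in> carrier G" "f \<in> step_functions (carrier G)"
  shows "translate (inv g) (translate g f) = f" "translate g (translate (inv g) f) = f"
  using assms by (simp_all add: translate_translate translate_one)

lemma step_dist_translate:
  assumes "g \<in> carrier G" "f \<in> step_functions (carrier G)" "h \<in> step_functions (carrier G)"
  shows "step_dist (translate g f) (translate g h) = step_dist f h"
  using assms step_function_closed by (simp add: step_dist_def translate_def)

lemma step_dist_translate_self:
  assumes "g \<in> carrier G" "f \<in> step_functions (carrier G)" "g \<noteq> \<one>"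
  shows "step_dist f (translate g f) = 1"
proof -
  have "f t \<noteq> translate g f t" for t
    using assms step_function_closed[OF assms(2), of t] r_cancel_one'[of "f t" g] by (simp add: translate_def)
  then have "{t \<in> {0..<1}. f t \<noteq> translate g f t} = {0..<1}"
    by auto
  then show ?thesis
    by (simp add: step_dist_def)
qed

interpretation E: Metric_space "step_functions (carrier G)" step_dist
  by (rule Metric_space_step_functions)

text \<open>Estimates of the infimum are reduced to a single translating element; the infimum itself
  need not be attained for this.\<close>

lemma orbit_dist_less_iff:
  assumes "f \<in> step_functions (carrier G)" "h \<in> step_functions (carrier G)"
  shows "orbit_dist f h < r \<longleftrightarrow> (\<exists>g\<in>carrier G. step_dist (translate g f) h < r)"
proof -
  have "bdd_below ((\<lambda>g. step_dist (translate g f) h) ` carrier G)"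
    by (rule bdd_belowI2[of _ 0]) simp
  from cINF_less_iff[OF carrier_not_empty this] show ?thesis
    using assms by (simp add: orbit_dist_def)
qed

lemma orbit_dist_nonneg: "0 \<le> orbit_dist f h"
  unfolding orbit_dist_def using cINF_greatest[OF carrier_not_empty, of 0 "\<lambda>g. step_dist (translate g f) h"]
  by simp

lemma orbit_dist_le_step_dist:
  assumes "f \<in> step_functions (carrier G)" "h \<in> step_functions (carrier G)"
  shows "orbit_dist f h \<le> step_dist f h"
  using orbit_dist_less_iff[OF assms, of "orbit_dist f h"] translate_one[OF assms(1)]
  by (metis less_irrefl not_le one_closed)

text \<open>If \<open>g\<close> moves \<open>f\<close> close to \<open>h\<close>, then
  \<open>b \<otimes> g \<otimes> inv a\<close> moves \<open>translate a f\<close> equally close to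
  \<open>translate b h\<close>.\<close>

lemma orbit_dist_translate_le:
  assumes "a \<in> carrier G" "b \<in> carrier G" "f \<in> step_functions (carrier G)" "h \<in> step_functions (carrier G)"
  shows "orbit_dist (translate a f) (translate b h) \<le> orbit_dist f h"
proof (rule ccontr)
  assume "\<not> ?thesis"
  then obtain g where g: "g \<in> carrier G" "step_dist (translate g f) h < orbit_dist (translate a f) (translate b h)"
    using orbit_dist_less_iff[OF assms(3,4)] by (meson not_le)
  have "translate (b \<otimes> g \<otimes> inv a) (translate a f) = translate b (translate g f)"
    using assms g by (simp add: translate_translate m_assoc)
  then have "step_dist (translate (b \<otimes> g \<otimes> inv a) (translate a f)) (translate b h) = step_dist (translate g f) h"
    using assms g by (simp add: step_dist_translate translate_closed)
  then have "orbit_dist (translate a f) (translate b h) < orbit_dist (translate a f) (translate b h)"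
    using orbit_dist_less_iff[OF translate_closed[OF assms(1,3)] translate_closed[OF assms(2,4)]] g assms
    by (metis inv_closed m_closed)
  then show False
    by simp
qed

lemma orbit_dist_le_commute:
  assumes "f \<in> step_functions (carrier G)" "h \<in> step_functions (carrier G)"
  shows "orbit_dist f h \<le> orbit_dist h f"
proof (rule ccontr)
  assume "\<not> ?thesis"
  then obtain g where g: "g \<in> carrier G" "step_dist (translate g h) f < orbit_dist f h"
    using orbit_dist_less_iff[OF assms(2,1)] by (meson not_le)
  have "step_dist (translate (inv g) f) h = step_dist (translate g (translate (inv g) f)) (translate g h)"
    using assms g by (simp add: step_dist_translate translate_closed)
  also have "\<dots> = step_dist (translate g h) f"
    using assms g by (simp add: translate_inv_cancel E.commute)
  finally have "orbit_dist f h < orbit_dist f h"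
    using orbit_dist_less_iff[OF assms] g by (metis inv_closed)
  then show False
    by simp
qed

lemma orbit_dist_triangle:
  assumes f: "f \<in> step_functions (carrier G)" and h: "h \<in> step_functions (carrier G)"
    and k: "k \<in> step_functions (carrier G)"
  shows "orbit_dist f k \<le> orbit_dist f h + orbit_dist h k"
proof (rule field_le_epsilon)
  fix e :: real assume "e > 0"
  then have "orbit_dist f h < orbit_dist f h + e / 2" "orbit_dist h k < orbit_dist h k + e / 2"
    by simp_all
  then obtain a b where a: "a \<in> carrier G" "step_dist (translate a f) h < orbit_dist f h + e / 2"
    and b: "b \<in> carrier G" "step_dist (translate b h) k < orbit_dist h k + e / 2"
    unfolding orbit_dist_less_iff[OF f h, of "orbit_dist f h + e / 2"] orbit_dist_less_iff[OF h k, of "orbit_dist h k + e / 2"]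
    by blast
  have "step_dist (translate (b \<otimes> a) f) k
      \<le> step_dist (translate b (translate a f)) (translate b h) + step_dist (translate b h) k"
    using E.triangle[of "translate (b \<otimes> a) f" "translate b h" k] a b f h k
    by (simp add: translate_closed translate_translate)
  also have "\<dots> < orbit_dist f h + orbit_dist h k + e"
    using a b f h by (simp add: step_dist_translate translate_closed)
  finally have "orbit_dist f k < orbit_dist f h + orbit_dist h k + e"
    unfolding orbit_dist_less_iff[OF f k] using a b by blast
  then show "orbit_dist f k \<le> orbit_dist f h + orbit_dist h k + e"
    by simp
qed

lemma based_step_functionsD: "f \<in> based_step_functions \<Longrightarrow> f \<in> step_functions (carrier G)"
  by (simp add: based_step_functions_def)

lemma normalize_in:
  assumes "f \<in> step_functions (carrier G)"
  shows "normalize f \<in> based_step_functions"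
  using assms translate_closed[OF inv_closed[OF step_function_closed[OF assms, of 0]] assms]
    step_function_closed[OF assms, of 0]
  by (simp add: based_step_functions_def normalize_def translate_def)

lemma normalize_translate_based:
  assumes "g \<in> carrier G" "f \<in> based_step_functions"
  shows "normalize (translate g f) = f"
proof -
  have f: "f \<in> step_functions (carrier G)" "f 0 = \<one>"
    using assms(2) by (auto simp: based_step_functions_def)
  then have "translate g f 0 = g"
    using assms(1) by (simp add: translate_def)
  then show ?thesis
    using translate_inv_cancel(1)[OF assms(1) f(1)] by (simp add: normalize_def)
qed

lemma translate_normalize:
  assumes "f \<in> step_functions (carrier G)"
  shows "translate (f 0) (normalize f) = f"
  unfolding normalize_def
  using translate_inv_cancel(2)[OF step_function_closed[OF assms, of 0] assms] .

lemma normalize_translate: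
  assumes "g \<in> carrier G" "f \<in> step_functions (carrier G)"
  shows "normalize (translate g f) = normalize f"
proof -
  have "translate g f = translate (g \<otimes> f 0) (normalize f)"
    using translate_normalize[OF assms(2)] translate_translate[OF assms(1) step_function_closed[OF assms(2), of 0]
        based_step_functionsD[OF normalize_in[OF assms(2)]]] by simp
  then show ?thesis
    using normalize_translate_based[OF _ normalize_in[OF assms(2)]] assms step_function_closed by simp
qed

lemma normalize_eq_imp_translate:
  assumes f: "f \<in> step_functions (carrier G)" and h: "h \<in> step_functions (carrier G)"
    and eq: "normalize f = normalize h"
  shows "\<exists>g\<in>carrier G. h = translate g f"
proof
  have "h = translate (h 0) (translate (inv (f 0)) f)"
    using translate_normalize[OF h] eq by (simp add: normalize_def)
  then show "h = translate (h 0 \<otimes> inv (f 0)) f"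
    using translate_translate[of "h 0" "inv (f 0)" f] f h step_function_closed by simp
  show "h 0 \<otimes> inv (f 0) \<in> carrier G"
    using f h step_function_closed by simp
qed

text \<open>The two functions differ by a translation, and a nontrivial one changes every value,
  which amounts to distance 1.\<close>

lemma normalize_separated:
  assumes f: "f \<in> step_functions (carrier G)" and h: "h \<in> step_functions (carrier G)"
    and eq: "normalize f = normalize h" and less: "step_dist f h < 1"
  shows "f = h"
proof -
  obtain g where g: "g \<in> carrier G" "h = translate g f"
    using normalize_eq_imp_translate[OF f h eq] by blast
  then have "g = \<one>"
    using step_dist_translate_self[OF g(1) f] less by auto
  then show ?thesis
    using g translate_one[OF f] by simp
qed

lemma normalize_based:
  assumes "f \<in> based_step_functions"
  shows "normalize f = f"
  using normalize_translate_based[OF one_closed assms] translate_one[OF based_step_functionsD[OF assms]] by simp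

text \<open>Translations are isometries: instead of moving \<open>f\<close> close to
  \<open>b\<close>, the inverse translation moves \<open>b\<close> close to \<open>f\<close> without
  leaving the orbit of \<open>b\<close>.\<close>

lemma orbit_dist_lift:
  assumes f: "f \<in> step_functions (carrier G)" and b: "b \<in> based_step_functions"
    and less: "orbit_dist (normalize f) b < r"
  shows "\<exists>h\<in>step_functions (carrier G). normalize h = b \<and> step_dist f h < r"
proof -
  have b': "b \<in> step_functions (carrier G)"
    using b by (rule based_step_functionsD)
  have f0: "f 0 \<in> carrier G"
    using f by (rule step_function_closed)
  obtain g where g: "g \<in> carrier G" "step_dist (translate g (normalize f)) b < r"
    using less orbit_dist_less_iff[OF based_step_functionsD[OF normalize_in[OF f]] b'] by blast
  define k where "k = g \<otimes> inv (f 0)"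
  have k: "k \<in> carrier G"
    using g f0 by (simp add: k_def)
  have "translate g (normalize f) = translate k f"
    using g f0 f by (simp add: k_def normalize_def translate_translate)
  moreover have "step_dist f (translate (inv k) b) = step_dist (translate k f) (translate k (translate (inv k) b))"
    using k f b' by (simp add: step_dist_translate translate_closed)
  ultimately have "step_dist f (translate (inv k) b) < r"
    using g k b' by (simp add: translate_inv_cancel)
  moreover have "normalize (translate (inv k) b) = b"
    using k b by (simp add: normalize_translate_based)
  ultimately show ?thesis
    using translate_closed[OF inv_closed[OF k] b'] by blast
qed

lemma Metric_space_orbit_dist: "Metric_space based_step_functions orbit_dist"
proof
  fix f h k
  show "0 \<le> orbit_dist f h"
    by (rule orbit_dist_nonneg)
  show "orbit_dist f h = orbit_dist h f"
  proof (cases "f \<in> step_functions (carrier G) \<and> h \<in> step_functions (carrier G)")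
    case True
    then show ?thesis
      by (intro antisym orbit_dist_le_commute) simp_all
  qed (auto simp: orbit_dist_def)
  assume f: "f \<in> based_step_functions" and h: "h \<in> based_step_functions"
  then have f': "f \<in> step_functions (carrier G)" and h': "h \<in> step_functions (carrier G)"
    by (auto dest: based_step_functionsD)
  show "orbit_dist f h = 0 \<longleftrightarrow> f = h"
  proof
    assume zero: "orbit_dist f h = 0"
    \<comment> \<open>Points over \<open>h\<close> are at least 1 apart, so those within 1/2 of
      \<open>f\<close> all equal \<open>u\<close>; since some are arbitrarily close to
      \<open>f\<close>, the point \<open>u\<close> is \<open>f\<close>.\<close>
    obtain u where u: "u \<in> step_functions (carrier G)" "normalize u = h" "step_dist f u < 1/2"
      using orbit_dist_lift[OF f' h, of "1/2"] zero normalize_based[OF f] by auto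
    have "step_dist f u \<le> 0 + e" if "e > 0" for e
    proof -
      obtain v where v: "v \<in> step_functions (carrier G)" "normalize v = h" "step_dist f v < min e (1/2)"
        using orbit_dist_lift[OF f' h, of "min e (1/2)"] zero normalize_based[OF f] \<open>e > 0\<close> by auto
      have "step_dist u v \<le> step_dist u f + step_dist f v"
        using u v f' by (intro E.triangle)
      then have "u = v"
        using u v normalize_separated[of u v] by (simp add: E.commute)
      then show ?thesis
        using v by simp
    qed
    then have "step_dist f u \<le> 0"
      by (rule field_le_epsilon)
    then have "f = u"
      using f' u(1) E.nonneg[of f u] E.zero[of f u] by simp
    then show "f = h"
      using u(2) normalize_based[OF f] by simp
  next
    assume "f = h"
    then show "orbit_dist f h = 0"
      using orbit_dist_le_step_dist[OF f' f'] orbit_dist_nonneg[of f f] f' by simp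
  qed
  assume k: "k \<in> based_step_functions"
  show "orbit_dist f k \<le> orbit_dist f h + orbit_dist h k"
    by (intro orbit_dist_triangle f' h' based_step_functionsD[OF k])
qed

lemma metric_covering_normalize:
  "metric_covering (step_functions (carrier G)) step_dist based_step_functions orbit_dist normalize"
proof -
  interpret B: Metric_space based_step_functions orbit_dist
    by (rule Metric_space_orbit_dist)
  show ?thesis
  proof
    fix f h b and r :: real
    assume f: "f \<in> step_functions (carrier G)"
    show "normalize f \<in> based_step_functions"
      using f by (rule normalize_in)
    show "\<exists>h\<in>step_functions (carrier G). normalize h = b \<and> step_dist f h < r"
      if "b \<in> based_step_functions" "orbit_dist (normalize f) b < r"
      using f that by (rule orbit_dist_lift)
    assume h: "h \<in> step_functions (carrier G)"
    have "orbit_dist (normalize f) (normalize h) \<le> orbit_dist f h"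
      unfolding normalize_def
      using f h by (intro orbit_dist_translate_le inv_closed step_function_closed)
    also have "\<dots> \<le> step_dist f h"
      using f h by (rule orbit_dist_le_step_dist)
    finally show "orbit_dist (normalize f) (normalize h) \<le> step_dist f h" .
    show "f = h" if "normalize f = normalize h" "step_dist f h < 1"
      using f h that by (rule normalize_separated)
  qed
qed

interpretation cover: metric_covering "step_functions (carrier G)" step_dist
    based_step_functions orbit_dist normalize
  by (rule metric_covering_normalize)

lemma nonmeasurable_based_step_functions:
  assumes "\<not> measurable_cardinality (carrier G)"
  shows "\<not> measurable_cardinality based_step_functions"
proof (rule nonmeasurable_if_countably_separated[OF assms])
  show "f (of_rat (nat_to_rat_surj n)) \<in> carrier G" if "f \<in> based_step_functions" for n f
    using based_step_functionsD[OF that] by (rule step_function_closed)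
  show "f = h" if f: "f \<in> based_step_functions" and h: "h \<in> based_step_functions"
    and eq: "\<And>n. f (of_rat (nat_to_rat_surj n)) = h (of_rat (nat_to_rat_surj n))" for f h
  proof (rule step_functions_eqI[OF based_step_functionsD[OF f] based_step_functionsD[OF h]])
    fix t :: real assume t: "t \<in> {0..<1}"
    obtain e where e: "e > 0" "\<And>s. s \<in> {t..<t+e} \<Longrightarrow> f s = f t"
      using step_functions_rightD[OF based_step_functionsD[OF f] t] by blast
    obtain e' where e': "e' > 0" "\<And>s. s \<in> {t..<t+e'} \<Longrightarrow> h s = h t"
      using step_functions_rightD[OF based_step_functionsD[OF h] t] by blast
    \<comment> \<open>To the right of \<open>t\<close> and so close that both functions still have
      their values at \<open>t\<close>.\<close>
    obtain q where q: "t < of_rat q" "of_rat q < t + min e e'"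
      using of_rat_dense[of t "t + min e e'"] e(1) e'(1) by auto
    obtain n where "q = nat_to_rat_surj n"
      using surj_nat_to_rat_surj by (auto simp: surj_def)
    then have "f (of_rat q) = h (of_rat q)"
      using eq by simp
    moreover have "f (of_rat q) = f t" "h (of_rat q) = h t"
      using q by (auto intro!: e(2) e'(2))
    ultimately show "f t = h t"
      by simp
  qed
qed

section \<open>The compactified quotient and lifting from it\<close>

definition classifying_compactification :: "'a cube_point topology" where
  "classifying_compactification = stone_cech cover.B.mtopology"

text \<open>This is the covering projection followed by the embedding of the quotient into its
  compactification.\<close>

definition classifying_map :: "(real \<Rightarrow> 'a) \<Rightarrow> 'a cube_point" where
  "classifying_map f = unit_eval cover.B.mtopology (normalize f)"

definition classifying_point :: "'a cube_point" where
  "classifying_point = classifying_map (\<lambda>_. \<one>)"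

lemma embedding_unit_eval_based:
  "embedding_map cover.B.mtopology classifying_compactification (unit_eval cover.B.mtopology)"
  unfolding classifying_compactification_def
  by (intro embedding_map_unit_eval cover.B.Hausdorff_space_mtopology
      metrizable_imp_completely_regular_space cover.B.metrizable_space_mtopology)

lemma continuous_map_classifying_map:
  "continuous_map E.mtopology classifying_compactification classifying_map"
  unfolding classifying_map_def[abs_def]
proof -
  have "continuous_map cover.B.mtopology classifying_compactification (unit_eval cover.B.mtopology)"
    using homeomorphic_imp_continuous_map[OF embedding_unit_eval_based[unfolded embedding_map_def]]
    by (simp add: continuous_map_in_subtopology)
  from continuous_map_compose[OF cover.continuous_map_proj this]
  show "continuous_map E.mtopology classifying_compactification
      (\<lambda>f. unit_eval cover.B.mtopology (normalize f))"
    by (simp add: o_def)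
qed

lemma classifying_map_eq_imp_normalize_eq:
  assumes "f \<in> step_functions (carrier G)" "h \<in> step_functions (carrier G)"
    and "classifying_map f = classifying_map h"
  shows "normalize f = normalize h"
  using homeomorphic_imp_injective_map[OF embedding_unit_eval_based[unfolded embedding_map_def]]
    assms(3) normalize_in[OF assms(1)] normalize_in[OF assms(2)]
  by (simp add: classifying_map_def inj_on_eq_iff)

lemma classifying_map_translate:
  assumes "g \<in> carrier G" "f \<in> step_functions (carrier G)"
  shows "classifying_map (translate g f) = classifying_map f"
  using assms by (simp add: classifying_map_def normalize_translate)

lemma classifying_map_const:
  assumes "g \<in> carrier G"
  shows "classifying_map (\<lambda>_. g) = classifying_point"
  using classifying_map_translate[OF assms const_in_step_functions[OF one_closed]] assms
  by (simp add: classifying_point_def translate_def)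

text \<open>Lifts of loops end in the orbit of the constant function \<open>\<one>\<close>; this is
  how their end points name group elements.\<close>

lemma classifying_fibre_point:
  assumes f: "f \<in> step_functions (carrier G)" and eq: "classifying_map f = classifying_point"
  shows "\<exists>g\<in>carrier G. f = (\<lambda>_. g)"
proof -
  have one: "(\<lambda>_. \<one>) \<in> step_functions (carrier G)"
    by (rule const_in_step_functions) simp
  have "normalize (\<lambda>_. \<one>) = normalize f"
    using classifying_map_eq_imp_normalize_eq[OF one f] eq by (simp add: classifying_point_def)
  then obtain g where "g \<in> carrier G" "f = translate g (\<lambda>_. \<one>)"
    using normalize_eq_imp_translate[OF one f] by blast
  then show ?thesis
    by (auto simp: translate_def)
qed

lemma lift_unique_classifying:
  assumes F: "continuous_map (top_of_set T) E.mtopology F"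
    and F': "continuous_map (top_of_set T) E.mtopology F'"
    and eq: "\<And>t. t \<in> T \<Longrightarrow> classifying_map (F t) = classifying_map (F' t)"
    and T: "connected T" "a \<in> T" "F a = F' a" "t \<in> T"
  shows "F t = F' t"
proof (rule cover.lift_unique[OF F F' _ T])
  fix s assume "s \<in> T"
  moreover from this have "F s \<in> step_functions (carrier G)" "F' s \<in> step_functions (carrier G)"
    using F F' by (auto simp: continuous_map_def)
  ultimately show "normalize (F s) = normalize (F' s)"
    using eq classifying_map_eq_imp_normalize_eq by blast
qed

text \<open>Along the segment from 0 to \<open>t\<close>, \<open>u\<close> is a path that starts in
  the image of the quotient. Realcompactness keeps it there, so \<open>u\<close> can be pulled back
  through the embedding and lifted along the covering.\<close>

lemma lift_exists_classifying:
  fixes T :: "'t::real_normed_vector set"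
  assumes nm: "\<not> measurable_cardinality (carrier G)"
    and T: "compact T" "0 \<in> T" and star: "\<And>t c. \<lbrakk>t \<in> T; c \<in> {0..1}\<rbrakk> \<Longrightarrow> c *\<^sub>R t \<in> T"
    and u: "continuous_map (top_of_set T) classifying_compactification u"
    and a: "a \<in> step_functions (carrier G)" "classifying_map a = u 0"
  obtains F where "continuous_map (top_of_set T) E.mtopology F" "F 0 = a"
    "\<And>t. t \<in> T \<Longrightarrow> classifying_map (F t) = u t"
proof -
  let ?B = "cover.B.mtopology" and ?S = "unit_eval cover.B.mtopology ` based_step_functions"
  have rc: "realcompact_space ?B"
    by (intro cover.B.realcompact_space_mtopology nonmeasurable_based_step_functions nm)
  have image: "u t \<in> ?S" if t: "t \<in> T" for t
  proof -
    have "continuous_map (top_of_set {0..1}) (top_of_set T) (\<lambda>c. c *\<^sub>R t)"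
      using star[OF t] by (auto intro!: continuous_intros)
    from continuous_map_compose[OF this u]
    have "pathin (stone_cech ?B) (\<lambda>c. u (c *\<^sub>R t))"
      by (simp add: pathin_def classifying_compactification_def o_def)
    moreover have "u (0 *\<^sub>R t) \<in> unit_eval ?B ` topspace ?B"
      using normalize_in[OF a(1)] a(2) by (simp add: classifying_map_def flip: a(2))
    ultimately have "u (1 *\<^sub>R t) \<in> unit_eval ?B ` topspace ?B"
      using realcompact_space_path_in_image[OF rc, of "\<lambda>c. u (c *\<^sub>R t)" 1] by simp
    then show ?thesis
      by simp
  qed
  obtain j where j: "homeomorphic_maps ?B (subtopology classifying_compactification ?S) (unit_eval ?B) j"
    using embedding_unit_eval_based by (auto simp: embedding_map_def homeomorphic_map_maps)
  have jB: "j (unit_eval ?B b) = b" if "b \<in> based_step_functions" for b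
    using j that by (simp add: homeomorphic_maps_def)
  have "continuous_map (top_of_set T) (subtopology classifying_compactification ?S) u"
    using u image by (auto simp: continuous_map_in_subtopology)
  then have ju: "continuous_map (top_of_set T) ?B (j \<circ> u)"
    using j by (intro continuous_map_compose) (auto simp: homeomorphic_maps_def)
  have "normalize a = (j \<circ> u) 0"
    using jB[OF normalize_in[OF a(1)]] by (simp add: classifying_map_def flip: a(2))
  then obtain F where F: "continuous_map (top_of_set T) E.mtopology F" "F 0 = a"
    "\<And>t. t \<in> T \<Longrightarrow> normalize (F t) = (j \<circ> u) t"
    using cover.lift_exists[OF T star ju a(1)] by blast
  have "classifying_map (F t) = u t" if "t \<in> T" for t
    using image[OF that] F(3)[OF that] jB by (auto simp: classifying_map_def)
  then show ?thesis
    using F that by blast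
qed

section \<open>Loops classified by the end points of their lifts\<close>

definition is_loop_lift :: "(real \<Rightarrow> real \<Rightarrow> 'a) \<Rightarrow> (real \<Rightarrow> 'a cube_point) \<Rightarrow> bool" where
  "is_loop_lift F p \<longleftrightarrow> continuous_map (top_of_set {0..1}) E.mtopology F
     \<and> F 0 = (\<lambda>_. \<one>) \<and> (\<forall>t\<in>{0..1}. classifying_map (F t) = p t)"

text \<open>This is the monodromy of the loop; uniqueness of lifts makes the description definite
  whenever such a lift exists.\<close>

definition loop_end :: "(real \<Rightarrow> 'a cube_point) \<Rightarrow> 'a" where
  "loop_end p = (THE g. \<exists>F. is_loop_lift F p \<and> F 1 = (\<lambda>_. g))"

lemma loop_end_eqI:
  assumes F: "is_loop_lift F p" "F 1 = (\<lambda>_. g)"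
  shows "loop_end p = g"
  unfolding loop_end_def
proof (rule the_equality)
  show "\<exists>F. is_loop_lift F p \<and> F 1 = (\<lambda>_. g)"
    using F by blast
  fix g' assume "\<exists>F'. is_loop_lift F' p \<and> F' 1 = (\<lambda>_. g')"
  then obtain F' where F': "is_loop_lift F' p" "F' 1 = (\<lambda>_. g')"
    by blast
  have "F' 1 = F 1"
    by (rule lift_unique_classifying[of "{0..1}" F' F 0])
       (use F(1) F'(1) in \<open>auto simp: is_loop_lift_def\<close>)
  then show "g' = g"
    using F(2) F'(2) by (simp add: fun_eq_iff)
qed

lemma loop_lift:
  assumes nm: "\<not> measurable_cardinality (carrier G)"
    and p: "p \<in> loops classifying_compactification classifying_point"
  obtains F where "is_loop_lift F p" "F 1 = (\<lambda>_. loop_end p)" "loop_end p \<in> carrier G"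
proof -
  have one: "(\<lambda>_. \<one>) \<in> step_functions (carrier G)"
    by (rule const_in_step_functions) simp
  have pc: "continuous_map (top_of_set {0..1}) classifying_compactification p"
    and p01: "p 0 = classifying_point" "p 1 = classifying_point"
    using p by (auto simp: loops_def pathin_def)
  have "c *\<^sub>R t \<in> {0..1}" if "t \<in> {0..1}" "c \<in> {0..1}" for t c :: real
    using that by (auto intro: mult_le_one)
  then obtain F where F: "continuous_map (top_of_set {0..1}) E.mtopology F" "F 0 = (\<lambda>_. \<one>)"
    "\<And>t. t \<in> {0..1} \<Longrightarrow> classifying_map (F t) = p t"
    using lift_exists_classifying[OF nm _ _ _ pc one, of thesis] p01(1)
    by (auto simp: classifying_point_def)
  have lift: "is_loop_lift F p"
    using F by (simp add: is_loop_lift_def)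
  have "F 1 \<in> step_functions (carrier G)"
    using F(1) by (auto simp: continuous_map_def)
  then obtain g where g: "g \<in> carrier G" "F 1 = (\<lambda>_. g)"
    using classifying_fibre_point[of "F 1"] F(3)[of 1] p01(2) by auto
  then show ?thesis
    using that lift loop_end_eqI[OF lift g(2)] by simp
qed

lemma loop_end_surj:
  assumes g: "g \<in> carrier G"
  shows "\<exists>p\<in>loops classifying_compactification classifying_point. loop_end p = g"
proof
  \<comment> \<open>At time \<open>t\<close> the function is \<open>g\<close> before
    \<open>t\<close> and \<open>\<one>\<close> from \<open>t\<close> on: a path between the two
    constants, which have the same image.\<close>
  define F where "F t = splice t (\<lambda>_. g) (\<lambda>_. \<one>)" for t
  have cont: "continuous_map (top_of_set {0..1}) E.mtopology F"
    unfolding F_def using g by (intro continuous_map_splice) (auto intro: const_in_step_functions)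
  have F0: "F 0 = (\<lambda>_. \<one>)"
    by (simp add: F_def splice_0)
  have F1: "F 1 = (\<lambda>_. g)"
    by (simp add: F_def splice_1)
  show "classifying_map \<circ> F \<in> loops classifying_compactification classifying_point"
    using continuous_map_compose[OF cont continuous_map_classifying_map] g
    by (simp add: loops_def pathin_def F0 F1 classifying_map_const)
  show "loop_end (classifying_map \<circ> F) = g"
    by (rule loop_end_eqI[of F]) (use cont F0 F1 in \<open>auto simp: is_loop_lift_def\<close>)
qed

lemma continuous_map_translate:
  assumes "g \<in> carrier G"
  shows "continuous_map E.mtopology E.mtopology (translate g)"
  unfolding E.metric_continuous_map[OF E.Metric_space_axioms]
proof (intro conjI ballI allI impI)
  fix a and e :: real assume "a \<in> step_functions (carrier G)" "e > 0"
  then show "\<exists>\<delta>>0. \<forall>x. x \<in> step_functions (carrier G) \<and> step_dist a x < \<delta>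
      \<longrightarrow> step_dist (translate g a) (translate g x) < e"
    using assms by (intro exI[of _ e]) (auto simp: step_dist_translate)
qed (use assms translate_closed in auto)

text \<open>The lift of \<open>q\<close> is translated by \<open>loop_end p\<close> to start where
  the lift of \<open>p\<close> ends. Translation does not change the image, and left multiplication
  gives the product in the order of the loops.\<close>

lemma loop_end_join:
  assumes nm: "\<not> measurable_cardinality (carrier G)"
    and p: "p \<in> loops classifying_compactification classifying_point"
    and q: "q \<in> loops classifying_compactification classifying_point"
  shows "loop_end (loop_join p q) = loop_end p \<otimes> loop_end q"
proof -
  obtain F where F: "is_loop_lift F p" "F 1 = (\<lambda>_. loop_end p)" and g: "loop_end p \<in> carrier G"
    using loop_lift[OF nm p] .
  obtain F' where F': "is_loop_lift F' q" "F' 1 = (\<lambda>_. loop_end q)" and g': "loop_end q \<in> carrier G"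
    using loop_lift[OF nm q] .
  let ?I = "top_of_set {0..1::real}"
  have Fc: "continuous_map ?I E.mtopology F" and Fc': "continuous_map ?I E.mtopology F'"
    using F(1) F'(1) by (auto simp: is_loop_lift_def)
  define H where "H t = (if t \<le> 1/2 then F (2 * t) else translate (loop_end p) (F' (2 * t - 1)))" for t
  have "continuous_map ?I E.mtopology H"
    unfolding H_def
  proof (rule continuous_map_cases_le)
    show "continuous_map (subtopology ?I {t \<in> topspace ?I. t \<le> 1/2}) E.mtopology (\<lambda>t. F (2 * t))"
      by (rule continuous_map_compose[OF _ Fc, unfolded o_def])
         (auto simp: subtopology_subtopology intro!: continuous_intros)
    show "continuous_map (subtopology ?I {t \<in> topspace ?I. 1/2 \<le> t}) E.mtopology
        (\<lambda>t. translate (loop_end p) (F' (2 * t - 1)))"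
      by (rule continuous_map_compose[OF _ continuous_map_compose[OF Fc' continuous_map_translate[OF g]],
            unfolded o_def])
         (auto simp: subtopology_subtopology intro!: continuous_intros)
    show "F (2 * t) = translate (loop_end p) (F' (2 * t - 1))" if "t \<in> topspace ?I" "t = 1/2" for t
    proof -
      have "2 * t = 1" "2 * t - 1 = 0"
        using that by auto
      then show ?thesis
        using F(2) F'(1) g by (simp only:) (simp add: is_loop_lift_def translate_def)
    qed
  qed (auto intro!: continuous_intros)
  moreover have "classifying_map (H t) = loop_join p q t" if "t \<in> {0..1}" for t
  proof (cases "t \<le> 1/2")
    case True
    then show ?thesis
      using F(1) that by (simp add: H_def loop_join_def is_loop_lift_def)
  next
    case False
    then have t: "2 * t - 1 \<in> {0..1}"
      using that by auto
    then have "F' (2 * t - 1) \<in> step_functions (carrier G)"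
      using Fc' by (auto simp: continuous_map_def)
    then have "classifying_map (H t) = classifying_map (F' (2 * t - 1))"
      using False g by (simp add: H_def classifying_map_translate)
    also have "\<dots> = q (2 * t - 1)"
      using F'(1) t unfolding is_loop_lift_def by blast
    finally show ?thesis
      using False by (simp add: loop_join_def)
  qed
  moreover have "H 0 = (\<lambda>_. \<one>)"
    using F(1) by (simp add: H_def is_loop_lift_def)
  ultimately have "is_loop_lift H (loop_join p q)"
    by (simp add: is_loop_lift_def)
  moreover have "H 1 = (\<lambda>_. loop_end p \<otimes> loop_end q)"
    by (simp add: H_def F'(2) translate_def)
  ultimately show ?thesis
    by (rule loop_end_eqI)
qed

text \<open>The homotopy is lifted on the whole square; the two edges that go to the base point have
  constant lifts, so the lifts of \<open>p\<close> and \<open>q\<close> end alike.\<close>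

lemma loop_homotopy_imp_loop_end_eq:
  assumes nm: "\<not> measurable_cardinality (carrier G)"
    and p: "p \<in> loops classifying_compactification classifying_point"
    and hom: "(p, q) \<in> loop_homotopy classifying_compactification classifying_point"
  shows "loop_end p = loop_end q"
proof -
  let ?I = "top_of_set {0..1::real}"
  obtain h where h: "continuous_map (prod_topology ?I ?I) classifying_compactification h"
      "\<And>x. h (0, x) = p x" "\<And>x. h (1, x) = q x"
      "\<And>t. t \<in> {0..1} \<Longrightarrow> h (t, 0) = classifying_point \<and> h (t, 1) = classifying_point"
    using hom by (auto simp: loop_homotopy_def homotopic_with_def)
  let ?T = "{0..1::real} \<times> {0..1::real}"
  have hc: "continuous_map (top_of_set ?T) classifying_compactification h"
    using h(1) by (simp add: subtopology_Times)
  have one: "(\<lambda>_. \<one>) \<in> step_functions (carrier G)"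
    by (rule const_in_step_functions) simp
  have T: "compact ?T" "0 \<in> ?T"
    by (auto intro: compact_Times simp: zero_prod_def)
  have star: "c *\<^sub>R t \<in> ?T" if "t \<in> ?T" "c \<in> {0..1}" for t and c :: real
    using that by (auto simp: mult_le_one split: prod.splits)
  have "classifying_map (\<lambda>_. \<one>) = h 0"
    using h(4)[of 0] by (simp add: zero_prod_def classifying_point_def)
  then obtain F where F: "continuous_map (top_of_set ?T) E.mtopology F" "F 0 = (\<lambda>_. \<one>)"
    "\<And>z. z \<in> ?T \<Longrightarrow> classifying_map (F z) = h z"
    using lift_exists_classifying[OF nm T star hc one] by blast
  have slice: "continuous_map ?I E.mtopology (\<lambda>t. F (a t, b t))"
    if "continuous_on {0..1} a" "continuous_on {0..1} b" "a ` {0..1} \<subseteq> {0..1}" "b ` {0..1} \<subseteq> {0..1}" for a b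
    by (rule continuous_map_compose[OF _ F(1), unfolded o_def])
       (use that in \<open>auto intro!: continuous_on_Pair\<close>)
  \<comment> \<open>This edge of the square goes to the base point, so its lift agrees with the
    constant lift; the opposite edge is treated likewise below.\<close>
  have start: "F (s, 0) = (\<lambda>_. \<one>)" if "s \<in> {0..1}" for s
    by (rule lift_unique_classifying[of "{0..1}" "\<lambda>s. F (s, 0)" "\<lambda>_ _. \<one>" 0])
       (use that F(2,3) h(4) one in \<open>auto intro!: slice simp: zero_prod_def classifying_map_const\<close>)
  have lift_p: "is_loop_lift (\<lambda>t. F (0, t)) p"
    unfolding is_loop_lift_def using F(2,3) h(2) by (auto intro!: slice simp: zero_prod_def)
  have lift_q: "is_loop_lift (\<lambda>t. F (1, t)) q"
    unfolding is_loop_lift_def using F(3) h(3) start by (auto intro!: slice)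
  obtain F' where F': "is_loop_lift F' p" "F' 1 = (\<lambda>_. loop_end p)" and g: "loop_end p \<in> carrier G"
    using loop_lift[OF nm p] .
  have F01: "F (0, 1) = F' 1"
    by (rule lift_unique_classifying[of "{0..1}" "\<lambda>t. F (0, t)" F' 0])
       (use lift_p F'(1) in \<open>auto simp: is_loop_lift_def\<close>)
  have "F (1, 1) = (\<lambda>_. loop_end p)"
    by (rule lift_unique_classifying[of "{0..1}" "\<lambda>s. F (s, 1)" "\<lambda>_ _. loop_end p" 0])
       (use F(3) h(4) F01 F'(2) g const_in_step_functions[OF g] in \<open>auto intro!: slice simp: classifying_map_const\<close>)
  then show ?thesis
    using loop_end_eqI[OF lift_q] by simp
qed

text \<open>The lifts of \<open>p\<close> and \<open>q\<close> have the same end points; splicing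
  deforms one into the other, and the image of this deformation is the homotopy.\<close>

lemma loop_end_eq_imp_loop_homotopy:
  assumes nm: "\<not> measurable_cardinality (carrier G)"
    and p: "p \<in> loops classifying_compactification classifying_point"
    and q: "q \<in> loops classifying_compactification classifying_point"
    and eq: "loop_end p = loop_end q"
  shows "(p, q) \<in> loop_homotopy classifying_compactification classifying_point"
proof -
  obtain F where F: "is_loop_lift F p" "F 1 = (\<lambda>_. loop_end p)" and g: "loop_end p \<in> carrier G"
    using loop_lift[OF nm p] .
  obtain F' where F': "is_loop_lift F' q" "F' 1 = (\<lambda>_. loop_end q)"
    using loop_lift[OF nm q] .
  let ?I = "top_of_set {0..1::real}"
  have Fc: "continuous_map ?I E.mtopology F" and Fc': "continuous_map ?I E.mtopology F'"
    using F(1) F'(1) by (auto simp: is_loop_lift_def)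
  define H where "H z = splice (fst z) (F' (snd z)) (F (snd z))" for z :: "real \<times> real"
  have "continuous_map (prod_topology ?I ?I) euclideanreal fst"
    using continuous_map_fst[of ?I ?I] by (simp add: continuous_map_in_subtopology)
  then have H: "continuous_map (prod_topology ?I ?I) E.mtopology H"
    unfolding H_def
    by (intro continuous_map_splice continuous_map_compose[OF continuous_map_snd Fc, unfolded o_def]
        continuous_map_compose[OF continuous_map_snd Fc', unfolded o_def])
  \<comment> \<open>Both lifts agree at times 0 and 1 in a constant function, which splicing leaves
    alone, so the base point stays fixed.\<close>
  have same: "splice c (\<lambda>_. a) (\<lambda>_. a) = (\<lambda>_. a)" for c :: real and a :: 'a
    by (simp add: splice_def)
  have "homotopic_with (\<lambda>r. r 0 = classifying_point \<and> r 1 = classifying_point) ?I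
      classifying_compactification p q"
  proof (subst homotopic_with)
    show "\<exists>h. continuous_map (prod_topology ?I ?I) classifying_compactification h \<and>
        (\<forall>x\<in>topspace ?I. h (0, x) = p x) \<and> (\<forall>x\<in>topspace ?I. h (1, x) = q x) \<and>
        (\<forall>t\<in>{0..1}. h (t, 0) = classifying_point \<and> h (t, 1) = classifying_point)"
    proof (intro exI[of _ "classifying_map \<circ> H"] conjI ballI)
      show "continuous_map (prod_topology ?I ?I) classifying_compactification (classifying_map \<circ> H)"
        by (rule continuous_map_compose[OF H continuous_map_classifying_map])
      show "(classifying_map \<circ> H) (0, x) = p x" "(classifying_map \<circ> H) (1, x) = q x"
        if "x \<in> topspace ?I" for x
        using F(1) F'(1) that by (simp_all add: H_def splice_0 splice_1 is_loop_lift_def)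
      show "(classifying_map \<circ> H) (t, 0) = classifying_point"
        "(classifying_map \<circ> H) (t, 1) = classifying_point" for t
        using F F' eq g by (simp_all add: H_def is_loop_lift_def same classifying_map_const)
    qed
  qed auto
  then show ?thesis
    by (simp add: loop_homotopy_def)
qed

lemma fundamental_group_classifying_compactification:
  assumes nm: "\<not> measurable_cardinality (carrier G)"
  shows "fundamental_group classifying_compactification classifying_point \<cong> G"
proof (rule fundamental_group_iso[where e = loop_end])
  show "loop_end p \<in> carrier G" if "p \<in> loops classifying_compactification classifying_point" for p
    using loop_lift[OF nm that] .
qed (use loop_end_surj loop_end_join[OF nm] loop_homotopy_imp_loop_end_eq[OF nm]
      loop_end_eq_imp_loop_homotopy[OF nm] in blast)+

end

theorem corollary4:
  fixes G :: "('a, 'm) monoid_scheme"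
  assumes "group G"
    and "\<not> measurable_cardinality (carrier G)"
  shows "\<exists>(K :: 'a cube_point topology) x0.
           compact_space K \<and> Hausdorff_space K \<and> x0 \<in> topspace K \<and>
           fundamental_group K x0 \<cong> G"
proof -
  interpret group G
    by fact
  have "classifying_point \<in> topspace classifying_compactification"
    using continuous_map_classifying_map const_in_step_functions[OF one_closed]
    by (fastforce simp: continuous_map_def classifying_point_def Pi_iff
        Metric_space.topspace_mtopology[OF Metric_space_step_functions])
  then show ?thesis
    using fundamental_group_classifying_compactification[OF assms(2)]
      compact_space_stone_cech Hausdorff_space_stone_cech
    unfolding classifying_compactification_def by blast
qed

end
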